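(* Let $E=\{1,\dots,s\}$ be a finite set, $\mathbb{T}=\{0,-1,-2,\dots\}$, and let $M=(M_n)_{n\in\mathbb{T}}$ be a sequence of Markov kernels on $E$. Let $\mathbf{Q}$, the random maps $\Phi_{n,k}$ and the coalescence times $(T_n)_{n\in\mathbb{T}}$ be constructed from $M$ as in the context. Then any (and then all) of the following equivalent conditions 1. for all $k\in\mathbb{T}$ and $(x,x',z)\in E^3$, $\lim_{n\to-\infty}\big(M_{n,k}(x,z)-M_{n,k}(x',z)\big)=0$; 2. $\mathrm{card}(\Pi_M)=1$; 3. for all $k\in\mathbb{T}$, $\lim_{n\to-\infty}\beta(M_{n,k})=0$; 4. there exists a strictly decreasing sequence $(n_i)_{i\in\mathbb{N}}$ in $\mathbb{T}$ such that $\sum_{i=0}^\infty \big(1-\beta(M_{n_{i+1},n_i})\big)=\infty$ hold if and only if $$\mathbf{Q}(T_n>-\infty)=1\quad\text{for all } n\in\mathbb{T}. \qquad ( * )$$ Furthermore, if $( * )$ holds then $\mathbf{Q}(\Phi_{T_n,n}(x)\in\cdot\,)=\pi_n(\cdot)$ for all $x\in E$ and $n\in\mathbb{T}$, where $(\pi_n)_{n\in\mathbb{T}}$ is the unique sequence of absolute probabilities for $M$.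
   Context: Backward products: $M_{k,k}=Id$ and $M_{n-1,k}(x,x')=\sum_{z\in E}M_n(x,z)M_{n,k}(z,x')$ for $n\le k$ in $\mathbb{T}$, so $M_{n,k}=M_{n+1}M_{n+2}\cdots M_k$ for $n<k$; by convention $M_{n,k}=Id$ when $k\le n$. A sequence of absolute probabilities for $M$ is a family $\pi=(\pi_n)_{n\in\mathbb{T}}$ of probability distributions on $E$ with $\sum_{z\in E}\pi_{n-1}(z)M_n(z,x)=\pi_n(x)$ for all $n\in\mathbb{T}$, $x\in E$. $\Pi_M$ denotes the set of all such sequences (it is always non-empty). Dobrushin's coefficient of a Markov kernel $K$ on $E$ is $\beta(K)=\max_{(x,x')\in E^2}\|K(x,\cdot)-K(x',\cdot)\|$, with total variation distance $\|\mu-\nu\|=\frac12\sum_{x\in E}|\mu(x)-\nu(x)|$. That conditions 1-4 are mutually equivalent is a classical fact. Coupling: on $\Omega^\xi=(E^s)^{\mathbb{T}}$ with product $\sigma$-algebra and coordinate process $(\xi_n^x;\,x\in E,n\in\mathbb{T})$, $\mathbf{Q}$ is the probability measure under which all the $\xi_n^x$, $x\in E$, $n\in\mathbb{T}$, are independent and $\mathbf{Q}(\xi_n^x=x')=M_n(x,x')$. Define random maps $\Phi_n:E\to E$, $\Phi_n(x)=\xi_n^x$, and for $n<k$ in $\mathbb{T}$, $\Phi_{n,k}=\Phi_k\circ\Phi_{k-1}\circ\cdots\circ\Phi_{n+1}$. For $k\in\mathbb{T}$, $T_k=\sup\{n<k:\ \text{the image of }\Phi_{n,k}\text{ is a singleton}\}$,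 with $T_k=-\infty$ when this set is empty. *)

theory Defs
  imports "HOL-Probability.Probability"
begin

text \<open>
  The state space is the finite type \<open>'e\<close>. The time set \<open>{0, -1, -2, \<dots>}\<close> is \<open>{..0} :: int set\<close>;
  the value of a family of kernels \<open>M\<close> at a positive time is never used.
\<close>

definition tv_dist :: "'e::finite pmf \<Rightarrow> 'e pmf \<Rightarrow> real" where
  "tv_dist \<mu> \<nu> = (1/2) * (\<Sum>x\<in>UNIV. \<bar>pmf \<mu> x - pmf \<nu> x\<bar>)"

definition dobrushin :: "('e::finite \<Rightarrow> 'e pmf) \<Rightarrow> real" where
  "dobrushin K = Max ((\<lambda>(x, x'). tv_dist (K x) (K x')) ` UNIV)"

text \<open>
  \<open>back_prod M n k\<close> is the kernel \<open>M\<^sub>n\<^sub>+\<^sub>1 M\<^sub>n\<^sub>+\<^sub>2 \<cdots> M\<^sub>k\<close>; composition of kernels is \<^const>\<open>bind_pmf\<close>.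
\<close>

function back_prod :: "(int \<Rightarrow> 'e \<Rightarrow> 'e pmf) \<Rightarrow> int \<Rightarrow> int \<Rightarrow> 'e \<Rightarrow> 'e pmf" where
  "back_prod M n k x =
     (if k \<le> n then return_pmf x else bind_pmf (M (n + 1) x) (back_prod M (n + 1) k))"
  by pat_completeness auto
termination by (relation "Wellfounded.measure (\<lambda>(M, n, k, x). nat (k - n))") auto

declare back_prod.simps [simp del]

lemma back_prod_refl: "back_prod M k k x = return_pmf x"
  by (simp add: back_prod.simps)

lemma pmf_back_prod_step:
  fixes M :: "int \<Rightarrow> 'e::finite \<Rightarrow> 'e pmf"
  assumes "n \<le> k"
  shows "pmf (back_prod M (n - 1) k x) x' = (\<Sum>z\<in>UNIV. pmf (M n x) z * pmf (back_prod M n k z) x')"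
  using assms
  by (subst back_prod.simps) (simp add: pmf_bind integral_measure_pmf_real[where A = UNIV] mult.commute)

text \<open>
  The sequences are taken extensional (equal to \<^const>\<open>undefined\<close> at positive times), so that
  counting them is counting families indexed by the time set.
\<close>

definition absolute_probs :: "(int \<Rightarrow> 'e::finite \<Rightarrow> 'e pmf) \<Rightarrow> (int \<Rightarrow> 'e pmf) set" where
  "absolute_probs M =
     {\<pi> \<in> extensional {..0}. \<forall>n\<le>0. \<forall>x. (\<Sum>z\<in>UNIV. pmf (\<pi> (n - 1)) z * pmf (M n z) x) = pmf (\<pi> n) x}"

text \<open>
  A sample point \<open>\<omega>\<close> has coordinates \<open>\<omega> n x\<close>, so that \<open>\<omega> n\<close> is the value of the random map at time \<open>n\<close>.
\<close>

definition coupling :: "(int \<Rightarrow> 'e::finite \<Rightarrow> 'e pmf) \<Rightarrow> (int \<Rightarrow> 'e \<Rightarrow> 'e) measure" where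
  "coupling M = (\<Pi>\<^sub>M n\<in>{..0}. \<Pi>\<^sub>M x\<in>UNIV. measure_pmf (M n x))"

function comp_maps :: "(int \<Rightarrow> 'e \<Rightarrow> 'e) \<Rightarrow> int \<Rightarrow> int \<Rightarrow> 'e \<Rightarrow> 'e" where
  "comp_maps \<omega> n k = (if k \<le> n then id else \<omega> k \<circ> comp_maps \<omega> n (k - 1))"
  by pat_completeness auto
termination by (relation "Wellfounded.measure (\<lambda>(\<omega>, n, k). nat (k - n))") auto

declare comp_maps.simps [simp del]

text \<open>The supremum is taken in \<^typ>\<open>ereal\<close>, where the supremum of the empty set is \<open>-\<infinity>\<close>.\<close>

definition coal_time :: "(int \<Rightarrow> 'e \<Rightarrow> 'e) \<Rightarrow> int \<Rightarrow> ereal" where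
  "coal_time \<omega> k = (SUP n \<in> {n. n < k \<and> is_singleton (range (comp_maps \<omega> n k))}. ereal (of_int n))"

text \<open>
  The composed map started at the coalescence time. A finite coalescence time is an integer, so
  the floor only changes the type; where the time is \<open>-\<infinity>\<close> the value is irrelevant.
\<close>

definition coal_map :: "(int \<Rightarrow> 'e \<Rightarrow> 'e) \<Rightarrow> int \<Rightarrow> 'e \<Rightarrow> 'e" where
  "coal_map \<omega> k = comp_maps \<omega> \<lfloor>real_of_ereal (coal_time \<omega> k)\<rfloor> k"

definition as_coalescing :: "(int \<Rightarrow> 'e::finite \<Rightarrow> 'e pmf) \<Rightarrow> bool" where
  "as_coalescing M \<longleftrightarrow>
     (\<forall>n\<le>0. measure (coupling M) {\<omega> \<in> space (coupling M). coal_time \<omega> n > -\<infinity>} = 1)"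

lemma prob_space_coupling: "prob_space (coupling M)"
  unfolding coupling_def by (intro prob_space_PiM measure_pmf.prob_space_axioms)

lemma coupling_cylinder:
  fixes M :: "int \<Rightarrow> 'e::finite \<Rightarrow> 'e pmf"
  assumes "finite J" "J \<subseteq> {..0}"
  shows "measure (coupling M) {\<omega> \<in> space (coupling M). \<forall>n\<in>J. \<forall>x. \<omega> n x \<in> A n x} =
         (\<Prod>n\<in>J. \<Prod>x\<in>UNIV. measure_pmf.prob (M n x) (A n x))"
proof -
  let ?P = "\<lambda>n. \<Pi>\<^sub>M x\<in>UNIV. measure_pmf (M n x)"
  interpret O: product_prob_space ?P "{..0::int}"
    by (intro product_prob_spaceI prob_space_PiM measure_pmf.prob_space_axioms)
  have box: "measure (?P n) (\<Pi>\<^sub>E x\<in>UNIV. A n x) = (\<Prod>x\<in>UNIV. measure_pmf.prob (M n x) (A n x))" for n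
  proof -
    interpret finite_product_prob_space "\<lambda>x. measure_pmf (M n x)" UNIV
      by unfold_locales auto
    show ?thesis
      by (rule prob_times) auto
  qed
  have eq: "{\<omega> \<in> space (coupling M). \<forall>n\<in>J. \<forall>x. \<omega> n x \<in> A n x} =
      prod_emb {..0} ?P J (\<Pi>\<^sub>E n\<in>J. \<Pi>\<^sub>E x\<in>UNIV. A n x)"
    using assms(2) by (auto simp: coupling_def prod_emb_def space_PiM PiE_iff extensional_def)
  show ?thesis
    unfolding eq unfolding coupling_def
    using assms by (subst O.measure_PiM_emb) (auto simp: box)
qed

end

theory Submission imports Defs begin

text \<open>
  Write \<open>M\<^sub>n\<^sub>,\<^sub>k\<close> for the backward products and \<open>\<Phi>\<^sub>n\<^sub>,\<^sub>k\<close> for the composed random maps. Under the coupling,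
  \<open>\<Phi>\<^sub>n\<^sub>,\<^sub>k(x)\<close> has law \<open>M\<^sub>n\<^sub>,\<^sub>k(x, \<cdot>)\<close>, and once \<open>\<Phi>\<^sub>n\<^sub>,\<^sub>k\<close> is constant it equals \<open>\<Phi>\<^sub>m\<^sub>,\<^sub>k\<close> for every earlier \<open>m\<close>.
  Almost sure coalescence therefore means that the probability that \<open>\<Phi>\<^sub>n\<^sub>,\<^sub>k\<close> is not constant tends
  to 0 as \<open>n \<rightarrow> -\<infinity>\<close> (\<open>as_coalescing_iff\<close>). That probability bounds the difference of two rows of
  \<open>M\<^sub>n\<^sub>,\<^sub>k\<close>, so coalescence implies weak ergodicity.

  The converse is the heart of the matter, because the coupling is far from a maximal coupling. The
  images of two points move independently until they meet. Two independent points with laws \<open>p\<close>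
  and \<open>q\<close> on a set of \<open>s\<close> elements agree with probability
  \<open>\<Sum>p(z) q(z) \<ge> (\<Sum>min (p(z)) (q(z)))\<^sup>2 / s = (1 - \<parallel>p - q\<parallel>)\<^sup>2 / s\<close>, and the two points of the flow agree at least
  as often, as they stay together after meeting (\<open>prob_two_point_law_le_independent\<close>). Under weak
  ergodicity the time axis contains infinitely many disjoint blocks on which the Dobrushin
  coefficient is at most 1/2; on each of them two points merge with probability at least
  \<open>1 / (4 s)\<close> whatever happened before, so the probability of staying apart decays geometrically
  (\<open>two_point_law_geometric\<close>). A sum over pairs of points completes the argument.

  The classical equivalences use submultiplicativity of the Dobrushin coefficient, which turns
  divergence of \<open>\<Sum>(1 - \<beta>\<^sub>i)\<close> into \<open>\<Prod>\<beta>\<^sub>i = 0\<close>, and compactness: every subsequence of rows \<open>M\<^sub>n\<^sub>,\<^sub>k(x, \<cdot>)\<close>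
  has a further subsequence converging, for all \<open>k\<close> at once, to a sequence of absolute
  probabilities (\<open>back_prod_subsequence_absolute_probs\<close>). If two rows do not merge, two different
  limits arise. If they merge, all absolute probabilities equal the common limit of the rows. The
  law of the coalesced map is this same limit, since that map coincides with \<open>\<Phi>\<^sub>n\<^sub>,\<^sub>k\<close> outside an event
  of vanishing probability (\<open>tendsto_prob_coal_map\<close>).
\<close>

section \<open>Contraction of total variation by Markov kernels\<close>

lemma pmf_bind_finite:
  fixes \<mu> :: "'a::finite pmf"
  shows "pmf (bind_pmf \<mu> L) z = (\<Sum>x\<in>UNIV. pmf \<mu> x * pmf (L x) z)"
  by (simp add: pmf_bind integral_measure_pmf_real[where A = UNIV] mult.commute)

lemma sum_pmf_UNIV:
  fixes \<mu> :: "'a::finite pmf"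
  shows "(\<Sum>x\<in>UNIV. pmf \<mu> x) = 1"
  by (rule sum_pmf_eq_1) auto

lemma tv_dist_eq_min:
  "tv_dist \<mu> \<nu> = 1 - (\<Sum>x\<in>UNIV. min (pmf \<mu> x) (pmf \<nu> x))"
proof -
  have "\<bar>pmf \<mu> x - pmf \<nu> x\<bar> = pmf \<mu> x + pmf \<nu> x - 2 * min (pmf \<mu> x) (pmf \<nu> x)" for x
    by (auto simp: min_def abs_if)
  then show ?thesis
    by (simp add: tv_dist_def sum.distrib sum_subtractf sum_pmf_UNIV flip: sum_distrib_left)
qed

lemma tv_dist_nonneg: "0 \<le> tv_dist \<mu> \<nu>"
  by (simp add: tv_dist_def sum_nonneg)

lemma tv_dist_le_1: "tv_dist \<mu> \<nu> \<le> 1"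
  by (simp add: tv_dist_eq_min sum_nonneg)

lemma tv_dist_le_dobrushin: "tv_dist (K x) (K y) \<le> dobrushin K"
  unfolding dobrushin_def by (rule Max_ge) (auto intro!: image_eqI[of _ _ "(x, y)"])

lemma dobrushin_le: "(\<And>x y. tv_dist (K x) (K y) \<le> c) \<Longrightarrow> dobrushin K \<le> c"
  unfolding dobrushin_def by (subst Max_le_iff) auto

lemma dobrushin_nonneg: "0 \<le> dobrushin K"
  using tv_dist_le_dobrushin[of K undefined undefined] tv_dist_nonneg order_trans by blast

lemma dobrushin_le_1: "dobrushin K \<le> 1"
  by (intro dobrushin_le tv_dist_le_1)

text \<open>
  After removing the common part \<open>min \<mu> \<nu>\<close>, two measures \<open>a\<close> and \<open>b\<close> of the same mass
  \<open>h = tv_dist \<mu> \<nu>\<close> remain. Coupling them by the product measure \<open>a \<otimes> b\<close>, of mass \<open>h\<^sup>2\<close>, writes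
  \<open>h\<close> times the difference of the images as an integral of differences of two rows of \<open>L\<close>, and each such
  difference is controlled by the Dobrushin coefficient.
\<close>

lemma tv_dist_bind_le:
  fixes \<mu> \<nu> :: "'e::finite pmf"
  shows "tv_dist (bind_pmf \<mu> L) (bind_pmf \<nu> L) \<le> tv_dist \<mu> \<nu> * dobrushin L"
proof -
  \<comment> \<open>The parts of \<open>\<mu>\<close> and \<open>\<nu>\<close> in excess of their common part; they are mutually singular.\<close>
  define a where "a x = pmf \<mu> x - min (pmf \<mu> x) (pmf \<nu> x)" for x
  define b where "b x = pmf \<nu> x - min (pmf \<mu> x) (pmf \<nu> x)" for x
  define h where "h = tv_dist \<mu> \<nu>"
  define d where "d z = pmf (bind_pmf \<mu> L) z - pmf (bind_pmf \<nu> L) z" for z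
  have a0: "0 \<le> a x" and b0: "0 \<le> b x" for x
    by (auto simp: a_def b_def)
  have sa: "(\<Sum>x\<in>UNIV. a x) = h" and sb: "(\<Sum>x\<in>UNIV. b x) = h"
    by (simp_all add: a_def b_def h_def tv_dist_eq_min sum_subtractf sum_pmf_UNIV)
  have d: "d z = (\<Sum>x\<in>UNIV. a x * pmf (L x) z) - (\<Sum>y\<in>UNIV. b y * pmf (L y) z)" for z
    by (simp add: d_def pmf_bind_finite a_def b_def algebra_simps flip: sum_subtractf)
  have hd: "h * d z = (\<Sum>x\<in>UNIV. \<Sum>y\<in>UNIV. a x * b y * (pmf (L x) z - pmf (L y) z))" for z
  proof -
    have "h * (\<Sum>x\<in>UNIV. a x * pmf (L x) z) = (\<Sum>x\<in>UNIV. a x * pmf (L x) z) * (\<Sum>y\<in>UNIV. b y)"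
      by (simp add: sb)
    then have "h * (\<Sum>x\<in>UNIV. a x * pmf (L x) z) = (\<Sum>x\<in>UNIV. \<Sum>y\<in>UNIV. a x * b y * pmf (L x) z)"
      by (simp add: sum_product algebra_simps) (subst sum.swap, simp)
    moreover have "h * (\<Sum>y\<in>UNIV. b y * pmf (L y) z) = (\<Sum>x\<in>UNIV. \<Sum>y\<in>UNIV. a x * b y * pmf (L y) z)"
      unfolding sa[symmetric] by (simp add: sum_product mult_ac)
    ultimately show ?thesis
      by (simp add: d right_diff_distrib sum_subtractf)
  qed
  have "h * (\<Sum>z\<in>UNIV. \<bar>d z\<bar>) = (\<Sum>z\<in>UNIV. \<bar>h * d z\<bar>)"
    using tv_dist_nonneg[of \<mu> \<nu>] by (simp add: h_def abs_mult sum_distrib_left)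
  also have "\<dots> \<le> (\<Sum>z\<in>UNIV. \<Sum>x\<in>UNIV. \<Sum>y\<in>UNIV. a x * b y * \<bar>pmf (L x) z - pmf (L y) z\<bar>)"
  proof (rule sum_mono)
    fix z
    have "\<bar>h * d z\<bar> \<le> (\<Sum>x\<in>UNIV. \<bar>\<Sum>y\<in>UNIV. a x * b y * (pmf (L x) z - pmf (L y) z)\<bar>)"
      unfolding hd by (rule sum_abs)
    also have "\<dots> \<le> (\<Sum>x\<in>UNIV. \<Sum>y\<in>UNIV. \<bar>a x * b y * (pmf (L x) z - pmf (L y) z)\<bar>)"
      by (intro sum_mono sum_abs)
    finally show "\<bar>h * d z\<bar> \<le> (\<Sum>x\<in>UNIV. \<Sum>y\<in>UNIV. a x * b y * \<bar>pmf (L x) z - pmf (L y) z\<bar>)"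
      by (simp add: abs_mult a0 b0)
  qed
  also have "\<dots> = (\<Sum>x\<in>UNIV. \<Sum>y\<in>UNIV. \<Sum>z\<in>UNIV. a x * b y * \<bar>pmf (L x) z - pmf (L y) z\<bar>)"
    by (subst sum.swap, rule sum.cong[OF refl], rule sum.swap)
  also have "\<dots> = (\<Sum>x\<in>UNIV. \<Sum>y\<in>UNIV. a x * b y * (2 * tv_dist (L x) (L y)))"
    by (simp add: tv_dist_def sum_distrib_left)
  also have "\<dots> \<le> (\<Sum>x\<in>UNIV. \<Sum>y\<in>UNIV. a x * b y * (2 * dobrushin L))"
    by (intro sum_mono mult_left_mono tv_dist_le_dobrushin mult_nonneg_nonneg a0 b0) auto
  also have "\<dots> = h * h * (2 * dobrushin L)"
    using sum_product[of a UNIV b UNIV] by (simp add: sa sb flip: sum_distrib_right)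
  finally have key: "h * (2 * tv_dist (bind_pmf \<mu> L) (bind_pmf \<nu> L)) \<le> h * (h * (2 * dobrushin L))"
    by (simp add: tv_dist_def d_def mult.assoc)
  show ?thesis
  proof (cases "h = 0")
    case True
    have "a x = 0" "b x = 0" for x
      using sa sb True a0 b0 by (simp_all add: sum_nonneg_eq_0_iff)
    then have "d z = 0" for z
      by (simp add: d)
    then show ?thesis
      by (simp add: tv_dist_def[of "bind_pmf \<mu> L"] d_def tv_dist_nonneg dobrushin_nonneg)
  next
    case False
    then have "h > 0"
      using tv_dist_nonneg[of \<mu> \<nu>] by (simp add: h_def)
    then show ?thesis
      using key by (simp add: h_def)
  qed
qed


section \<open>Weak ergodicity of backward products\<close>

lemma back_prod_compose:
  assumes "n \<le> m" "m \<le> k"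
  shows "back_prod M n k x = bind_pmf (back_prod M n m x) (back_prod M m k)"
  using assms(1)
proof (induction n arbitrary: x rule: int_le_induct)
  case base
  then show ?case
    by (simp add: back_prod_refl bind_return_pmf)
next
  case (step i)
  have "back_prod M (i - 1) k x = bind_pmf (M i x) (back_prod M i k)"
    using step.hyps assms(2) by (subst back_prod.simps) simp
  also have "\<dots> = bind_pmf (M i x) (\<lambda>y. bind_pmf (back_prod M i m y) (back_prod M m k))"
    by (intro bind_pmf_cong refl step.IH)
  also have "\<dots> = bind_pmf (back_prod M (i - 1) m x) (back_prod M m k)"
    using step.hyps by (subst (2) back_prod.simps) (simp add: bind_assoc_pmf)
  finally show ?case .
qed

lemma back_prod_last:
  assumes "n < k"
  shows "back_prod M n k x = bind_pmf (back_prod M n (k - 1) x) (M k)"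
proof -
  have "back_prod M k k = return_pmf"
    by (simp add: back_prod_refl fun_eq_iff)
  then have "back_prod M (k - 1) k y = M k y" for y
    by (simp add: back_prod.simps[of M "k - 1"] bind_return_pmf')
  then have "back_prod M (k - 1) k = M k"
    by blast
  then show ?thesis
    using back_prod_compose[of n "k - 1" k M x] assms by simp
qed

lemma dobrushin_back_prod_compose:
  fixes M :: "int \<Rightarrow> 'e::finite \<Rightarrow> 'e pmf"
  assumes "n \<le> m" "m \<le> k"
  shows "dobrushin (back_prod M n k) \<le> dobrushin (back_prod M n m) * dobrushin (back_prod M m k)"
proof (rule dobrushin_le)
  fix x y
  have "tv_dist (back_prod M n k x) (back_prod M n k y)
        \<le> tv_dist (back_prod M n m x) (back_prod M n m y) * dobrushin (back_prod M m k)"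
    unfolding back_prod_compose[OF assms, of M x] back_prod_compose[OF assms, of M y]
    by (rule tv_dist_bind_le)
  also have "\<dots> \<le> dobrushin (back_prod M n m) * dobrushin (back_prod M m k)"
    by (intro mult_right_mono tv_dist_le_dobrushin dobrushin_nonneg)
  finally show "tv_dist (back_prod M n k x) (back_prod M n k y)
      \<le> dobrushin (back_prod M n m) * dobrushin (back_prod M m k)" .
qed

lemma dobrushin_back_prod_le:
  fixes M :: "int \<Rightarrow> 'e::finite \<Rightarrow> 'e pmf"
  assumes "n \<le> m" "m \<le> m'" "m' \<le> k"
  shows "dobrushin (back_prod M n k) \<le> dobrushin (back_prod M m m')"
proof -
  have "dobrushin (back_prod M n k) \<le> dobrushin (back_prod M n m) * dobrushin (back_prod M m k)"
    using assms by (intro dobrushin_back_prod_compose) auto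
  also have "\<dots> \<le> 1 * dobrushin (back_prod M m k)"
    by (intro mult_right_mono dobrushin_le_1 dobrushin_nonneg)
  also have "\<dots> \<le> 1 * (dobrushin (back_prod M m m') * dobrushin (back_prod M m' k))"
    using assms by (simp add: dobrushin_back_prod_compose)
  also have "\<dots> \<le> dobrushin (back_prod M m m')"
    by (simp add: dobrushin_le_1 dobrushin_nonneg mult_left_le)
  finally show ?thesis .
qed

text \<open>
  The coefficient dominates every entrywise difference of two rows and is itself dominated by the
  finite sum of the total variation distances over all pairs of rows.
\<close>

lemma tendsto_dobrushin_iff:
  fixes K :: "'a \<Rightarrow> 'e::finite \<Rightarrow> 'e pmf"
  shows "((\<lambda>n. dobrushin (K n)) \<longlongrightarrow> 0) F \<longleftrightarrow>
         (\<forall>x x' z. ((\<lambda>n. pmf (K n x) z - pmf (K n x') z) \<longlongrightarrow> 0) F)"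
proof (intro iffI allI)
  fix x x' z
  assume "((\<lambda>n. dobrushin (K n)) \<longlongrightarrow> 0) F"
  then have lim: "((\<lambda>n. 2 * dobrushin (K n)) \<longlongrightarrow> 0) F"
    by (rule tendsto_mult_right_zero)
  have "\<bar>pmf (K n x) z - pmf (K n x') z\<bar> \<le> 2 * dobrushin (K n)" for n
  proof -
    have "\<bar>pmf (K n x) z - pmf (K n x') z\<bar> \<le> (\<Sum>z\<in>UNIV. \<bar>pmf (K n x) z - pmf (K n x') z\<bar>)"
      by (rule member_le_sum) auto
    also have "\<dots> = 2 * tv_dist (K n x) (K n x')"
      by (simp add: tv_dist_def)
    also have "\<dots> \<le> 2 * dobrushin (K n)"
      by (simp add: tv_dist_le_dobrushin)
    finally show ?thesis .
  qed
  then show "((\<lambda>n. pmf (K n x) z - pmf (K n x') z) \<longlongrightarrow> 0) F"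
    by (intro Lim_null_comparison[OF _ lim]) auto
next
  assume *: "\<forall>x x' z. ((\<lambda>n. pmf (K n x) z - pmf (K n x') z) \<longlongrightarrow> 0) F"
  have tv: "((\<lambda>n. tv_dist (K n x) (K n x')) \<longlongrightarrow> 0) F" for x x'
    unfolding tv_dist_def
    by (intro tendsto_mult_right_zero tendsto_null_sum tendsto_rabs_zero) (use * in auto)
  have lim: "((\<lambda>n. \<Sum>x\<in>UNIV. \<Sum>x'\<in>UNIV. tv_dist (K n x) (K n x')) \<longlongrightarrow> 0) F"
    by (intro tendsto_null_sum tv)
  have "dobrushin (K n) \<le> (\<Sum>x\<in>UNIV. \<Sum>x'\<in>UNIV. tv_dist (K n x) (K n x'))" for n
  proof (rule dobrushin_le)
    fix x y
    have "tv_dist (K n x) (K n y) \<le> (\<Sum>x'\<in>UNIV. tv_dist (K n x) (K n x'))"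
      by (rule member_le_sum) (auto simp: tv_dist_nonneg)
    also have "\<dots> \<le> (\<Sum>x\<in>UNIV. \<Sum>x'\<in>UNIV. tv_dist (K n x) (K n x'))"
      by (rule member_le_sum[where f = "\<lambda>x. \<Sum>x'\<in>UNIV. tv_dist (K n x) (K n x')"])
         (auto simp: tv_dist_nonneg sum_nonneg)
    finally show "tv_dist (K n x) (K n y) \<le> (\<Sum>x\<in>UNIV. \<Sum>x'\<in>UNIV. tv_dist (K n x) (K n x'))" .
  qed
  then show "((\<lambda>n. dobrushin (K n)) \<longlongrightarrow> 0) F"
    by (intro Lim_null_comparison[OF _ lim]) (auto simp: dobrushin_nonneg)
qed

lemma ex_small_dobrushin_block:
  fixes M :: "int \<Rightarrow> 'e::finite \<Rightarrow> 'e pmf"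
  assumes "((\<lambda>n. dobrushin (back_prod M n k)) \<longlongrightarrow> 0) at_bot"
  shows "\<exists>n<k. dobrushin (back_prod M n k) < 1/2"
proof -
  have "eventually (\<lambda>n. dobrushin (back_prod M n k) < 1/2 \<and> n < k) at_bot"
    by (intro eventually_conj order_tendstoD(2)[OF assms])
       (auto simp: eventually_at_bot_dense)
  then show ?thesis
    by (metis (no_types, lifting) eventually_at_bot_linorder order_refl)
qed

text \<open>
  Blocks are chosen greedily so that each contributes at least 1/2 to the sum.
\<close>

lemma dobrushin_tendsto_imp_block_divergence:
  fixes M :: "int \<Rightarrow> 'e::finite \<Rightarrow> 'e pmf"
  assumes lim: "\<forall>k\<le>0. ((\<lambda>n. dobrushin (back_prod M n k)) \<longlongrightarrow> 0) at_bot"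
  shows "\<exists>t :: nat \<Rightarrow> int. (\<forall>i. t i \<le> 0) \<and> (\<forall>i j. i < j \<longrightarrow> t j < t i) \<and>
           (\<Sum>i. ennreal (1 - dobrushin (back_prod M (t (Suc i)) (t i)))) = \<infinity>"
proof -
  have "\<forall>k. \<exists>n. k \<le> 0 \<longrightarrow> n < k \<and> dobrushin (back_prod M n k) < 1/2"
    using ex_small_dobrushin_block lim by blast
  then obtain s where s: "\<And>k. k \<le> 0 \<Longrightarrow> s k < k \<and> dobrushin (back_prod M (s k) k) < 1/2"
    by metis
  define t where "t i = (s ^^ i) 0" for i
  have t0: "t i \<le> 0" for i
    by (induction i) (use s in \<open>auto simp: t_def intro: less_imp_le less_le_trans\<close>)
  have tS: "t (Suc i) = s (t i)" for i
    by (simp add: t_def)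
  have "t j < t i" if "i < j" for i j
    using that by (induction rule: strict_inc_induct) (use s t0 tS in \<open>metis\<close>, use s t0 tS in \<open>metis less_trans\<close>)
  moreover have "(\<Sum>i. ennreal (1 - dobrushin (back_prod M (t (Suc i)) (t i)))) = \<infinity>"
  proof (rule ccontr)
    assume "\<not> ?thesis"
    then have "summable (\<lambda>i. 1 - dobrushin (back_prod M (t (Suc i)) (t i)))"
      by (intro summable_suminf_not_top) (auto simp: dobrushin_le_1)
    then have "(\<lambda>i. 1 - dobrushin (back_prod M (t (Suc i)) (t i))) \<longlonglongrightarrow> 0"
      by (rule summable_LIMSEQ_zero)
    moreover have "1/2 \<le> 1 - dobrushin (back_prod M (t (Suc i)) (t i))" for i
      using s[OF t0, of i] by (simp add: tS)
    ultimately have "(1/2 :: real) \<le> 0"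
      by (intro LIMSEQ_le_const) auto
    then show False
      by simp
  qed
  ultimately show ?thesis
    using t0 by blast
qed

text \<open>
  From \<open>\<beta> \<le> exp (- (1 - \<beta>))\<close> and submultiplicativity, the coefficient of a union of
  consecutive blocks is at most the exponential of minus a partial sum of the divergent series.
  Dropping the blocks after time \<open>k\<close> does not affect divergence.
\<close>

lemma block_divergence_imp_dobrushin_tendsto:
  fixes M :: "int \<Rightarrow> 'e::finite \<Rightarrow> 'e pmf" and t :: "nat \<Rightarrow> int"
  assumes dec: "\<forall>i j. i < j \<longrightarrow> t j < t i"
    and inf: "(\<Sum>i. ennreal (1 - dobrushin (back_prod M (t (Suc i)) (t i)))) = \<infinity>"
  shows "((\<lambda>n. dobrushin (back_prod M n k)) \<longlongrightarrow> 0) at_bot"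
proof -
  define \<beta> where "\<beta> i = dobrushin (back_prod M (t (Suc i)) (t i))" for i
  have \<beta>: "0 \<le> \<beta> i" "\<beta> i \<le> 1" for i
    by (simp_all add: \<beta>_def dobrushin_nonneg dobrushin_le_1)
  have mono: "t j \<le> t i" if "i \<le> j" for i j
    using dec that by (cases "i = j") (auto intro: less_imp_le)
  have "\<exists>j. t j \<le> k"
  proof -
    have "t i \<le> t 0 - int i" for i
    proof (induction i)
      case (Suc i)
      then show ?case
        using dec by (metis lessI add.commute add_le_imp_le_diff diff_diff_eq
          of_nat_Suc order_trans zless_imp_add1_zle)
    qed simp
    from this[of "nat (t 0 - k)"] show ?thesis
      by (intro exI[of _ "nat (t 0 - k)"]) (auto split: if_splits intro: order_trans)
  qed
  then obtain j where j: "t j \<le> k" ..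
  have prod: "dobrushin (back_prod M (t (j + m)) (t j)) \<le> exp (- (\<Sum>i<m. 1 - \<beta> (i + j)))" for m
  proof (induction m)
    case 0
    show ?case
      by (simp add: dobrushin_le_1)
  next
    case (Suc m)
    have "dobrushin (back_prod M (t (j + Suc m)) (t j))
        \<le> \<beta> (m + j) * dobrushin (back_prod M (t (j + m)) (t j))"
      unfolding \<beta>_def using dobrushin_back_prod_compose[OF mono mono, of "j + m" "j + Suc m" j M]
      by (simp add: add.commute)
    also have "\<dots> \<le> exp (- (1 - \<beta> (m + j))) * exp (- (\<Sum>i<m. 1 - \<beta> (i + j)))"
      using exp_ge_add_one_self[of "- (1 - \<beta> (m + j))"]
      by (intro mult_mono Suc.IH) (auto simp: dobrushin_nonneg)
    also have "\<dots> = exp (- (\<Sum>i<Suc m. 1 - \<beta> (i + j)))"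
      by (simp add: exp_add[symmetric] algebra_simps)
    finally show ?case .
  qed
  have unbounded: "\<exists>m. C < (\<Sum>i<m. 1 - \<beta> (i + j))" for C
  proof (rule ccontr)
    assume "\<not> ?thesis"
    then have "summable (\<lambda>i. 1 - \<beta> (i + j))"
      using \<beta> by (intro summableI_nonneg_bounded[where x = C]) (auto simp: not_less)
    then have "summable (\<lambda>i. 1 - \<beta> i)"
      by (rule summable_iff_shift[THEN iffD1])
    then have "(\<Sum>i. ennreal (1 - \<beta> i)) = ennreal (\<Sum>i. 1 - \<beta> i)"
      using \<beta> by (intro suminf_ennreal2) auto
    then show False
      using inf by (simp add: \<beta>_def)
  qed
  show ?thesis
  proof (rule order_tendstoI)
    fix a :: real
    assume "a < 0"
    then show "eventually (\<lambda>n. a < dobrushin (back_prod M n k)) at_bot"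
      by (intro always_eventually allI less_le_trans[OF _ dobrushin_nonneg])
  next
    fix a :: real
    assume a: "0 < a"
    obtain m where "- ln a < (\<Sum>i<m. 1 - \<beta> (i + j))"
      using unbounded by blast
    then have "exp (- (\<Sum>i<m. 1 - \<beta> (i + j))) < exp (ln a)"
      by (subst exp_less_cancel_iff) simp
    then have "dobrushin (back_prod M (t (j + m)) (t j)) < a"
      using prod[of m] a by simp
    then have "dobrushin (back_prod M n k) < a" if "n \<le> t (j + m)" for n
      using dobrushin_back_prod_le[OF that mono j, of M] by force
    then show "eventually (\<lambda>n. dobrushin (back_prod M n k) < a) at_bot"
      by (auto simp: eventually_at_bot_linorder)
  qed
qed

section \<open>Absolute probabilities as limits of backward products\<close>

lemma absolute_probs_iff_bind:
  "\<pi> \<in> absolute_probs M \<longleftrightarrow> \<pi> \<in> extensional {..0} \<and> (\<forall>n\<le>0. \<pi> n = bind_pmf (\<pi> (n - 1)) (M n))"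
  by (auto simp: absolute_probs_def pmf_bind_finite pmf_eq_iff)

lemma absolute_probs_back_prod:
  assumes "\<pi> \<in> absolute_probs M" "m \<le> n" "n \<le> 0"
  shows "\<pi> n = bind_pmf (\<pi> m) (back_prod M m n)"
  using assms(2)
proof (induction m rule: int_le_induct)
  case base
  have "back_prod M n n = return_pmf"
    by (simp add: back_prod_refl fun_eq_iff)
  then show ?case
    by (simp add: bind_return_pmf')
next
  case (step i)
  have "\<pi> i = bind_pmf (\<pi> (i - 1)) (M i)"
    using assms step.hyps unfolding absolute_probs_iff_bind by (meson order_trans)
  with step.IH have "\<pi> n = bind_pmf (bind_pmf (\<pi> (i - 1)) (M i)) (back_prod M i n)"
    by argo
  also have "\<dots> = bind_pmf (\<pi> (i - 1)) (back_prod M (i - 1) n)"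
    using step.hyps by (auto simp: bind_assoc_pmf back_prod.simps[of M "i - 1"] intro!: bind_pmf_cong)
  finally show ?case .
qed

text \<open>
  Since \<open>\<pi> n\<close> is the average of the rows of \<open>back_prod M m n\<close> weighted by \<open>\<pi> m\<close>, it is close to any
  single row as soon as all rows are close to each other, whatever \<open>\<pi> m\<close> is.
\<close>

lemma back_prod_tendsto_absolute_probs:
  fixes M :: "int \<Rightarrow> 'e::finite \<Rightarrow> 'e pmf"
  assumes \<pi>: "\<pi> \<in> absolute_probs M" and n: "n \<le> 0"
    and lim: "\<And>x x' z. ((\<lambda>m. pmf (back_prod M m n x) z - pmf (back_prod M m n x') z) \<longlongrightarrow> 0) at_bot"
  shows "((\<lambda>m. pmf (back_prod M m n x) z) \<longlongrightarrow> pmf (\<pi> n) z) at_bot"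
proof -
  let ?d = "\<lambda>m w. pmf (back_prod M m n x) z - pmf (back_prod M m n w) z"
  have lim0: "((\<lambda>m. \<Sum>w\<in>UNIV. \<bar>?d m w\<bar>) \<longlongrightarrow> 0) at_bot"
    by (intro tendsto_null_sum tendsto_rabs_zero lim)
  have bound: "norm (pmf (back_prod M m n x) z - pmf (\<pi> n) z) \<le> (\<Sum>w\<in>UNIV. \<bar>?d m w\<bar>)" if "m \<le> n" for m
  proof -
    have "pmf (back_prod M m n x) z - pmf (\<pi> n) z
        = (\<Sum>w\<in>UNIV. pmf (\<pi> m) w) * pmf (back_prod M m n x) z
          - (\<Sum>w\<in>UNIV. pmf (\<pi> m) w * pmf (back_prod M m n w) z)"
      by (simp add: sum_pmf_UNIV absolute_probs_back_prod[OF \<pi> that n] pmf_bind_finite)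
    also have "\<dots> = (\<Sum>w\<in>UNIV. pmf (\<pi> m) w * ?d m w)"
      by (simp add: sum_distrib_right right_diff_distrib sum_subtractf)
    finally have "norm (pmf (back_prod M m n x) z - pmf (\<pi> n) z) \<le> (\<Sum>w\<in>UNIV. \<bar>pmf (\<pi> m) w * ?d m w\<bar>)"
      by simp
    also have "\<dots> \<le> (\<Sum>w\<in>UNIV. \<bar>?d m w\<bar>)"
      by (intro sum_mono) (simp add: abs_mult mult_left_le_one_le pmf_le_1)
    finally show ?thesis .
  qed
  have "((\<lambda>m. pmf (back_prod M m n x) z - pmf (\<pi> n) z) \<longlongrightarrow> 0) at_bot"
    by (rule Lim_null_comparison[OF _ lim0]) (use bound in \<open>auto simp: eventually_at_bot_linorder\<close>)
  then show ?thesis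
    by (rule LIM_zero_cancel)
qed

text \<open>
  Tychonoff's theorem in the countable product of intervals \<open>[0, 1]\<close>, which is metrizable and hence
  sequentially compact. No mass is lost in the limit because each distribution lives on a finite
  set.
\<close>

lemma pmf_subsequence_convergent:
  fixes p :: "nat \<Rightarrow> int \<Rightarrow> 'e::finite pmf"
  shows "\<exists>r \<pi>. strict_mono r \<and> (\<forall>k z. (\<lambda>i. pmf (p (r i) k) z) \<longlonglongrightarrow> pmf (\<pi> k) z)"
proof -
  define f where "f i = (\<lambda>(k, z). pmf (p i k) z)" for i
  define K where "K = (\<Pi>\<^sub>E kz\<in>(UNIV :: (int \<times> 'e) set). {0..1::real})"
  have "compactin (product_topology (\<lambda>_. euclidean) UNIV) K"
    unfolding K_def by (simp add: compactin_PiE)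
  then have "compact K"
    unfolding euclidean_product_topology by simp
  then have "seq_compact K"
    by (rule compact_imp_seq_compact)
  moreover have "\<forall>i. f i \<in> K"
    unfolding K_def by (intro allI PiE_I) (simp_all add: f_def pmf_le_1 split_beta)
  ultimately obtain l r where "l \<in> K" and r: "strict_mono r" and l: "(f \<circ> r) \<longlonglongrightarrow> l"
    by (rule seq_compactE)
  have lim: "(\<lambda>i. pmf (p (r i) k) z) \<longlonglongrightarrow> l (k, z)" for k z
  proof -
    have "isCont (\<lambda>g :: int \<times> 'e \<Rightarrow> real. g (k, z)) l"
      by (rule continuous_on_interior[OF continuous_on_product_coordinates]) simp
    from isCont_tendsto_compose[OF this l] show ?thesis
      by (simp add: f_def)
  qed
  have nn: "0 \<le> l (k, z)" for k z
    using LIMSEQ_le_const[OF lim[of k z], of 0] by simp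
  have one: "(\<Sum>z\<in>UNIV. l (k, z)) = 1" for k
  proof -
    have "(\<lambda>i. \<Sum>z\<in>UNIV. pmf (p (r i) k) z) \<longlonglongrightarrow> (\<Sum>z\<in>UNIV. l (k, z))"
      by (intro tendsto_sum lim)
    from LIMSEQ_unique[OF this] show ?thesis
      by (simp add: sum_pmf_UNIV)
  qed
  define \<pi> where "\<pi> k = embed_pmf (\<lambda>z. l (k, z))" for k
  have pmf_\<pi>: "pmf (\<pi> k) z = l (k, z)" for k z
    unfolding \<pi>_def by (rule pmf_embed_pmf) (simp_all add: nn nn_integral_count_space_finite one)
  show ?thesis
  proof (intro exI conjI allI)
    show "strict_mono r"
      by (fact r)
    show "(\<lambda>i. pmf (p (r i) k) z) \<longlonglongrightarrow> pmf (\<pi> k) z" for k z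
      unfolding pmf_\<pi> by (fact lim)
  qed
qed

text \<open>
  A single subsequence must work at all times \<open>k\<close> simultaneously: the relation
  \<open>back_prod M n k x = bind_pmf (back_prod M n (k - 1) x) (M k)\<close> between times \<open>k - 1\<close> and \<open>k\<close> then
  passes to the limit and becomes the defining relation of absolute probabilities.
\<close>

lemma back_prod_subsequence_absolute_probs:
  fixes M :: "int \<Rightarrow> 'e::finite \<Rightarrow> 'e pmf"
  assumes u: "filterlim u at_bot sequentially"
  shows "\<exists>r \<pi>. strict_mono r \<and> \<pi> \<in> absolute_probs M \<and>
           (\<forall>k\<le>0. \<forall>z. (\<lambda>i. pmf (back_prod M (u (r i)) k x) z) \<longlonglongrightarrow> pmf (\<pi> k) z)"
proof -
  obtain r \<rho> where r: "strict_mono r"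
    and lim: "\<And>k z. (\<lambda>i. pmf (back_prod M (u (r i)) k x) z) \<longlonglongrightarrow> pmf (\<rho> k) z"
    using pmf_subsequence_convergent[of "\<lambda>i k. back_prod M (u i) k x"] by metis
  have ur: "filterlim (\<lambda>i. u (r i)) at_bot sequentially"
    using filterlim_compose[OF u filterlim_subseq[OF r]] by (simp add: o_def)
  have \<rho>: "\<rho> n = bind_pmf (\<rho> (n - 1)) (M n)" if "n \<le> 0" for n
  proof (rule pmf_eqI)
    fix z
    have "eventually (\<lambda>i. u (r i) \<le> n - 1) sequentially"
      using ur unfolding filterlim_at_bot by blast
    then have "eventually (\<lambda>i. (\<Sum>w\<in>UNIV. pmf (back_prod M (u (r i)) (n - 1) x) w * pmf (M n w) z)
        = pmf (back_prod M (u (r i)) n x) z) sequentially"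
      by eventually_elim
         (subst back_prod_last[of _ n], simp_all add: pmf_bind_finite)
    moreover have "(\<lambda>i. \<Sum>w\<in>UNIV. pmf (back_prod M (u (r i)) (n - 1) x) w * pmf (M n w) z)
        \<longlonglongrightarrow> (\<Sum>w\<in>UNIV. pmf (\<rho> (n - 1)) w * pmf (M n w) z)"
      by (intro tendsto_intros lim)
    ultimately have "(\<lambda>i. pmf (back_prod M (u (r i)) n x) z)
        \<longlonglongrightarrow> (\<Sum>w\<in>UNIV. pmf (\<rho> (n - 1)) w * pmf (M n w) z)"
      by (rule Lim_transform_eventually[rotated])
    from LIMSEQ_unique[OF lim this]
    show "pmf (\<rho> n) z = pmf (bind_pmf (\<rho> (n - 1)) (M n)) z"
      by (simp add: pmf_bind_finite)
  qed
  define \<pi> where "\<pi> = restrict \<rho> {..0}"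
  have "\<pi> \<in> absolute_probs M"
    unfolding absolute_probs_iff_bind
  proof (intro conjI allI impI)
    show "\<pi> \<in> extensional {..0}"
      by (simp add: \<pi>_def)
    show "\<pi> n = bind_pmf (\<pi> (n - 1)) (M n)" if "n \<le> 0" for n
      using \<rho>[OF that] that by (simp add: \<pi>_def)
  qed
  moreover have "(\<lambda>i. pmf (back_prod M (u (r i)) k x) z) \<longlonglongrightarrow> pmf (\<pi> k) z" if "k \<le> 0" for k z
    using lim that by (simp add: \<pi>_def)
  ultimately show ?thesis
    using r by blast
qed

lemma filterlim_neg_nat_at_bot: "filterlim (\<lambda>i. c - int i) at_bot sequentially"
  unfolding filterlim_at_bot
proof
  fix Z
  show "eventually (\<lambda>i. c - int i \<le> Z) sequentially"
    by (intro eventually_sequentiallyI[of "nat (c - Z)"]) auto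
qed

lemma absolute_probs_nonempty:
  fixes M :: "int \<Rightarrow> 'e::finite \<Rightarrow> 'e pmf"
  shows "absolute_probs M \<noteq> {}"
proof -
  obtain r \<pi> where "\<pi> \<in> absolute_probs M"
    using back_prod_subsequence_absolute_probs[OF filterlim_neg_nat_at_bot[of 0], of M undefined] by metis
  then show ?thesis
    by auto
qed

lemma not_tendsto_0_at_bot_subseq:
  fixes f :: "int \<Rightarrow> real"
  assumes "\<not> (f \<longlongrightarrow> 0) at_bot"
  shows "\<exists>\<epsilon>>0. \<exists>u. filterlim u at_bot sequentially \<and> (\<forall>i::nat. \<epsilon> \<le> \<bar>f (u i)\<bar>)"
proof -
  obtain \<epsilon> where \<epsilon>: "\<epsilon> > 0" "\<not> eventually (\<lambda>n. \<bar>f n\<bar> < \<epsilon>) at_bot"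
    using assms by (auto simp: tendsto_iff)
  then have "\<forall>i. \<exists>n. n \<le> 0 - int i \<and> \<epsilon> \<le> \<bar>f n\<bar>"
    by (simp add: eventually_at_bot_linorder not_less)
  then obtain u where u: "\<And>i. u i \<le> 0 - int i" "\<And>i. \<epsilon> \<le> \<bar>f (u i)\<bar>"
    by metis
  have "filterlim u at_bot sequentially"
    by (rule filterlim_at_bot_mono[OF filterlim_neg_nat_at_bot[of 0]]) (use u in auto)
  then show ?thesis
    using u \<epsilon> by blast
qed

text \<open>
  If two rows stay apart along some sequence of times, extracting limits for the first row and then
  for the second along a common subsequence gives two distinct sequences of absolute probabilities.
\<close>

lemma card_absolute_probs_iff:
  fixes M :: "int \<Rightarrow> 'e::finite \<Rightarrow> 'e pmf"
  shows "card (absolute_probs M) = 1 \<longleftrightarrow>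
    (\<forall>k\<le>0. \<forall>x x' z. ((\<lambda>n. pmf (back_prod M n k x) z - pmf (back_prod M n k x') z) \<longlongrightarrow> 0) at_bot)"
proof
  assume "card (absolute_probs M) = 1"
  then obtain \<pi> where single: "absolute_probs M = {\<pi>}"
    by (auto simp: card_1_singleton_iff)
  show "\<forall>k\<le>0. \<forall>x x' z. ((\<lambda>n. pmf (back_prod M n k x) z - pmf (back_prod M n k x') z) \<longlongrightarrow> 0) at_bot"
  proof (intro allI impI, rule ccontr)
    fix k :: int and x x' z
    assume k: "k \<le> 0"
    assume "\<not> ((\<lambda>n. pmf (back_prod M n k x) z - pmf (back_prod M n k x') z) \<longlongrightarrow> 0) at_bot"
    then obtain \<epsilon> u where \<epsilon>: "\<epsilon> > 0" and u: "filterlim u at_bot sequentially"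
      and far: "\<And>i::nat. \<epsilon> \<le> \<bar>pmf (back_prod M (u i) k x) z - pmf (back_prod M (u i) k x') z\<bar>"
      using not_tendsto_0_at_bot_subseq by blast
    obtain r \<rho> where r: "strict_mono r" and "\<rho> \<in> absolute_probs M"
      and "\<forall>k\<le>0. \<forall>z. (\<lambda>i. pmf (back_prod M (u (r i)) k x) z) \<longlonglongrightarrow> pmf (\<rho> k) z"
      using back_prod_subsequence_absolute_probs[OF u, of M x] by (elim exE conjE)
    then have lim: "(\<lambda>i. pmf (back_prod M (u (r i)) k x) z) \<longlonglongrightarrow> pmf (\<pi> k) z"
      using k by (simp add: single)
    have ur: "filterlim (\<lambda>i. u (r i)) at_bot sequentially"
      using filterlim_compose[OF u filterlim_subseq[OF r]] by (simp add: o_def)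
    \<comment> \<open>The second extraction refines the first, so both rows converge along the same times.\<close>
    obtain r' \<rho>' where r': "strict_mono r'" and "\<rho>' \<in> absolute_probs M"
      and "\<forall>k\<le>0. \<forall>z. (\<lambda>i. pmf (back_prod M (u (r (r' i))) k x') z) \<longlonglongrightarrow> pmf (\<rho>' k) z"
      using back_prod_subsequence_absolute_probs[OF ur, of M x'] by (elim exE conjE)
    then have lim': "(\<lambda>i. pmf (back_prod M (u (r (r' i))) k x') z) \<longlonglongrightarrow> pmf (\<pi> k) z"
      using k by (simp add: single)
    have "(\<lambda>i. \<bar>pmf (back_prod M (u (r (r' i))) k x) z - pmf (back_prod M (u (r (r' i))) k x') z\<bar>)
        \<longlonglongrightarrow> \<bar>pmf (\<pi> k) z - pmf (\<pi> k) z\<bar>"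
      using LIMSEQ_subseq_LIMSEQ[OF lim r', unfolded o_def] lim'
      by (intro tendsto_rabs tendsto_diff)
    from LIMSEQ_le_const[OF this, of \<epsilon>] far have "\<epsilon> \<le> \<bar>pmf (\<pi> k) z - pmf (\<pi> k) z\<bar>"
      by blast
    with \<epsilon> show False
      by simp
  qed
next
  assume lim: "\<forall>k\<le>0. \<forall>x x' z. ((\<lambda>n. pmf (back_prod M n k x) z - pmf (back_prod M n k x') z) \<longlongrightarrow> 0) at_bot"
  obtain \<pi> where \<pi>: "\<pi> \<in> absolute_probs M"
    using absolute_probs_nonempty[of M] by blast
  have "\<rho> = \<pi>" if \<rho>: "\<rho> \<in> absolute_probs M" for \<rho>
  proof (rule extensionalityI[of _ "{..0}"])
    show "\<rho> \<in> extensional {..0}" "\<pi> \<in> extensional {..0}"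
      using \<pi> \<rho> by (auto simp: absolute_probs_def)
    fix n :: int
    assume "n \<in> {..0}"
    then have "((\<lambda>m. pmf (back_prod M m n undefined) z) \<longlongrightarrow> pmf (\<rho> n) z) at_bot"
              "((\<lambda>m. pmf (back_prod M m n undefined) z) \<longlongrightarrow> pmf (\<pi> n) z) at_bot" for z
      using lim \<pi> \<rho> by (simp_all add: back_prod_tendsto_absolute_probs)
    then show "\<rho> n = \<pi> n"
      by (intro pmf_eqI) (metis tendsto_unique trivial_limit_at_bot_linorder)
  qed
  with \<pi> have "absolute_probs M = {\<pi>}"
    by blast
  then show "card (absolute_probs M) = 1"
    by simp
qed

section \<open>Laws of the composed random maps\<close>

lemma prob_bind_finite:
  fixes p :: "'a::finite pmf" and f :: "'a \<Rightarrow> 'b::finite pmf"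
  shows "measure_pmf.prob (bind_pmf p f) A = (\<Sum>x\<in>UNIV. pmf p x * measure_pmf.prob (f x) A)"
proof -
  have "(\<Sum>b\<in>A. \<Sum>x\<in>UNIV. pmf p x * pmf (f x) b) = (\<Sum>x\<in>UNIV. \<Sum>b\<in>A. pmf p x * pmf (f x) b)"
    by (rule sum.swap)
  then show ?thesis
    by (simp add: measure_measure_pmf_finite pmf_bind_finite sum_distrib_left)
qed

definition map_law :: "(int \<Rightarrow> 'e::finite \<Rightarrow> 'e pmf) \<Rightarrow> int \<Rightarrow> ('e \<Rightarrow> 'e) pmf" where
  "map_law M n = Pi_pmf UNIV undefined (M n)"

text \<open>
  Only the coordinates at times in \<open>{n<..k}\<close> enter the composition, so its law is an image of a finite
  product and is available without the infinite product measure.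
\<close>

definition flow_law :: "(int \<Rightarrow> 'e::finite \<Rightarrow> 'e pmf) \<Rightarrow> int \<Rightarrow> int \<Rightarrow> ('e \<Rightarrow> 'e) pmf" where
  "flow_law M n k = map_pmf (\<lambda>\<omega>. comp_maps \<omega> n k) (Pi_pmf {n<..k} undefined (map_law M))"

lemma comp_maps_cong:
  "(\<And>j. n < j \<Longrightarrow> j \<le> k \<Longrightarrow> \<omega> j = \<omega>' j) \<Longrightarrow> comp_maps \<omega> n k = comp_maps \<omega>' n k"
proof (induction \<omega> n k rule: comp_maps.induct)
  case (1 \<omega> n k)
  then show ?case
    by (cases "k \<le> n") (simp_all add: comp_maps.simps[of _ n k])
qed

lemma flow_law_refl: "flow_law M n n = return_pmf id"
  by (simp add: flow_law_def comp_maps.simps)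

lemma flow_law_last:
  assumes "n < k"
  shows "flow_law M n k = bind_pmf (flow_law M n (k - 1)) (\<lambda>\<phi>. map_pmf (\<lambda>\<psi>. \<psi> \<circ> \<phi>) (map_law M k))"
proof -
  have set: "{n<..k} = insert k {n<..k - 1}"
    using assms by auto
  have comp: "comp_maps (f(k := y)) n k = y \<circ> comp_maps f n (k - 1)" for f :: "int \<Rightarrow> 'b \<Rightarrow> 'b" and y
    using assms by (simp add: comp_maps.simps[of _ n k] comp_maps_cong[of n "k - 1" "f(k := y)" f])
  have "flow_law M n k = bind_pmf (map_law M k) (\<lambda>y. bind_pmf (Pi_pmf {n<..k - 1} undefined (map_law M))
      (\<lambda>f. return_pmf (y \<circ> comp_maps f n (k - 1))))"
    unfolding flow_law_def set
    by (subst Pi_pmf_insert') (simp_all add: map_bind_pmf comp)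
  also have "\<dots> = bind_pmf (Pi_pmf {n<..k - 1} undefined (map_law M)) (\<lambda>f. bind_pmf (map_law M k)
      (\<lambda>y. return_pmf (y \<circ> comp_maps f n (k - 1))))"
    by (rule bind_commute_pmf)
  also have "\<dots> = bind_pmf (flow_law M n (k - 1)) (\<lambda>\<phi>. map_pmf (\<lambda>\<psi>. \<psi> \<circ> \<phi>) (map_law M k))"
    by (simp add: flow_law_def map_pmf_def bind_assoc_pmf bind_return_pmf)
  finally show ?thesis .
qed

text \<open>
  The flow property: the maps before and after time \<open>m\<close> are independent.
\<close>

lemma flow_law_compose:
  assumes "n \<le> m" "m \<le> k"
  shows "flow_law M n k = bind_pmf (flow_law M n m) (\<lambda>\<phi>. map_pmf (\<lambda>\<psi>. \<psi> \<circ> \<phi>) (flow_law M m k))"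
  using assms(2)
proof (induction k rule: int_ge_induct)
  case base
  show ?case
    by (simp add: flow_law_refl bind_return_pmf')
next
  case (step i)
  then show ?case
    using assms(1)
    by (simp add: flow_law_last[of n "i + 1"] flow_law_last[of m "i + 1"] map_pmf_def
        bind_assoc_pmf bind_return_pmf o_def)
qed

definition two_point_law :: "(int \<Rightarrow> 'e::finite \<Rightarrow> 'e pmf) \<Rightarrow> int \<Rightarrow> int \<Rightarrow> 'e \<times> 'e \<Rightarrow> ('e \<times> 'e) pmf" where
  "two_point_law M n k = (\<lambda>(x, y). map_pmf (\<lambda>\<phi>. (\<phi> x, \<phi> y)) (flow_law M n k))"

lemma two_point_law_compose:
  assumes "n \<le> m" "m \<le> k"
  shows "two_point_law M n k xy = bind_pmf (two_point_law M n m xy) (two_point_law M m k)"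
  by (cases xy) (simp add: two_point_law_def flow_law_compose[OF assms] map_pmf_def
      bind_assoc_pmf bind_return_pmf)

lemma one_point_map_law: "map_pmf (\<lambda>\<phi>. \<phi> x) (map_law M n) = M n x"
  by (simp add: map_law_def Pi_pmf_component)

lemma one_point_flow_law:
  assumes "n \<le> k"
  shows "map_pmf (\<lambda>\<phi>. \<phi> x) (flow_law M n k) = back_prod M n k x"
  using assms
proof (induction k rule: int_ge_induct)
  case base
  show ?case
    by (simp add: flow_law_refl back_prod_refl)
next
  case (step i)
  have "map_pmf (\<lambda>\<phi>. \<phi> x) (flow_law M n (i + 1))
      = bind_pmf (flow_law M n i) (\<lambda>\<phi>. map_pmf (\<lambda>\<psi>. \<psi> (\<phi> x)) (map_law M (i + 1)))"
    using step.hyps by (simp add: flow_law_last[of n "i + 1"] map_bind_pmf pmf.map_comp o_def)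
  also have "\<dots> = bind_pmf (map_pmf (\<lambda>\<phi>. \<phi> x) (flow_law M n i)) (M (i + 1))"
    by (simp add: one_point_map_law bind_map_pmf)
  also have "\<dots> = back_prod M n (i + 1) x"
    using step.hyps by (simp add: step.IH back_prod_last[of n "i + 1"])
  finally show ?case .
qed

text \<open>
  The values of a single random map at two distinct points are independent. Together with
  independence over time and the laws of single points, this is all that the decay of two-point
  probabilities uses.
\<close>

lemma two_point_map_law:
  assumes "x \<noteq> y"
  shows "map_pmf (\<lambda>\<phi>. (\<phi> x, \<phi> y)) (map_law M n) = pair_pmf (M n x) (M n y)"
proof -
  have UNIV_eq: "UNIV = insert x (insert y (UNIV - {x, y}))"
    by auto
  have "map_law M n = Pi_pmf (insert x (insert y (UNIV - {x, y}))) undefined (M n)"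
    unfolding map_law_def by (rule arg_cong[OF UNIV_eq])
  also have "\<dots> = do {a \<leftarrow> M n x; b \<leftarrow> M n y; f \<leftarrow> Pi_pmf (UNIV - {x, y}) undefined (M n);
      return_pmf (f(y := b, x := a))}"
    using assms by (subst Pi_pmf_insert', simp, simp, subst Pi_pmf_insert') (simp_all add: bind_assoc_pmf bind_return_pmf)
  finally show ?thesis
    using assms by (simp add: map_bind_pmf pair_pmf_def)
qed

lemma flow_law_single: "flow_law M (n - 1) n = map_law M n"
  using flow_law_last[of "n - 1" n M] by (simp add: flow_law_refl bind_return_pmf)


section \<open>Coalescence of two points of the flow\<close>

abbreviation off_diag :: "('a \<times> 'a) set" where
  "off_diag \<equiv> {xy. fst xy \<noteq> snd xy}"

text \<open>
  Two distinct points make the same first step as an independent pair, so the bound propagates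
  backwards in time. Two equal points stay equal under the flow, whereas an independent pair may
  separate again.
\<close>

lemma prob_two_point_law_le_independent:
  assumes "n \<le> k"
  shows "measure_pmf.prob (two_point_law M n k (x, y)) off_diag
       \<le> measure_pmf.prob (pair_pmf (back_prod M n k x) (back_prod M n k y)) off_diag"
  using assms
proof (induction n arbitrary: x y rule: int_le_induct)
  case base
  show ?case
    by (simp add: two_point_law_def flow_law_refl back_prod_refl)
next
  case (step i)
  show ?case
  proof (cases "x = y")
    case True
    then have "measure_pmf.prob (two_point_law M (i - 1) k (x, y)) off_diag = 0"
      by (simp add: two_point_law_def vimage_def)
    then show ?thesis
      by simp
  next
    case False
    have "two_point_law M (i - 1) i (x, y) = pair_pmf (M i x) (M i y)"
      using False by (simp add: two_point_law_def flow_law_single two_point_map_law)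
    then have "two_point_law M (i - 1) k (x, y)
        = bind_pmf (pair_pmf (M i x) (M i y)) (two_point_law M i k)"
      using step.hyps by (simp add: two_point_law_compose[of "i - 1" i k])
    then have "measure_pmf.prob (two_point_law M (i - 1) k (x, y)) off_diag
        = (\<Sum>ab\<in>UNIV. pmf (pair_pmf (M i x) (M i y)) ab * measure_pmf.prob (two_point_law M i k ab) off_diag)"
      by (simp add: prob_bind_finite)
    also have "\<dots> \<le> (\<Sum>ab\<in>UNIV. pmf (pair_pmf (M i x) (M i y)) ab
        * measure_pmf.prob (pair_pmf (back_prod M i k (fst ab)) (back_prod M i k (snd ab))) off_diag)"
    proof (intro sum_mono mult_left_mono)
      fix ab
      show "measure_pmf.prob (two_point_law M i k ab) off_diag
          \<le> measure_pmf.prob (pair_pmf (back_prod M i k (fst ab)) (back_prod M i k (snd ab))) off_diag"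
        using step.IH[of "fst ab" "snd ab"] by simp
    qed simp
    also have "\<dots> = measure_pmf.prob (bind_pmf (pair_pmf (M i x) (M i y))
        (\<lambda>ab. pair_pmf (back_prod M i k (fst ab)) (back_prod M i k (snd ab)))) off_diag"
      by (simp add: prob_bind_finite)
    also have "bind_pmf (pair_pmf (M i x) (M i y))
        (\<lambda>ab. pair_pmf (back_prod M i k (fst ab)) (back_prod M i k (snd ab)))
        = pair_pmf (back_prod M (i - 1) k x) (back_prod M (i - 1) k y)"
    proof -
      have step1: "back_prod M (i - 1) k w = bind_pmf (M i w) (back_prod M i k)" for w
        using step.hyps by (simp add: back_prod.simps[of M "i - 1"])
      show ?thesis
        unfolding step1 pair_pmf_def
        by (simp add: bind_assoc_pmf bind_return_pmf bind_commute_pmf[of "M i y"])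
    qed
    finally show ?thesis .
  qed
qed

text \<open>
  Cauchy--Schwarz applied to \<open>\<Sum>min (p z) (q z) = 1 - tv_dist p q\<close> bounds from below the probability
  \<open>\<Sum>p z * q z\<close> that two independent samples agree.
\<close>

lemma prob_pair_off_diag_le:
  fixes p q :: "'e::finite pmf"
  shows "measure_pmf.prob (pair_pmf p q) off_diag \<le> 1 - (1 - tv_dist p q)\<^sup>2 / real CARD('e)"
proof -
  have diag: "measure_pmf.prob (pair_pmf p q) (- off_diag) = (\<Sum>z\<in>UNIV. pmf p z * pmf q z)"
  proof -
    have "- off_diag = (\<lambda>z :: 'e. (z, z)) ` UNIV"
      by auto
    then show ?thesis
      by (simp add: measure_measure_pmf_finite sum.reindex inj_on_def pmf_pair)
  qed
  have "(1 - tv_dist p q)\<^sup>2 = (\<Sum>z\<in>UNIV. min (pmf p z) (pmf q z))\<^sup>2"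
    by (simp add: tv_dist_eq_min)
  also have "\<dots> \<le> (\<Sum>z\<in>UNIV. (min (pmf p z) (pmf q z))\<^sup>2) * real CARD('e)"
    by (rule sum_squared_le_sum_of_squares)
  also have "\<dots> \<le> (\<Sum>z\<in>UNIV. pmf p z * pmf q z) * real CARD('e)"
    by (intro mult_right_mono sum_mono) (auto simp: power2_eq_square intro: mult_mono)
  finally have "(1 - tv_dist p q)\<^sup>2 / real CARD('e) \<le> measure_pmf.prob (pair_pmf p q) (- off_diag)"
    by (simp add: diag divide_le_eq)
  then show ?thesis
    using measure_pmf.prob_compl[of off_diag "pair_pmf p q"] by (simp add: Compl_eq_Diff_UNIV)
qed

text \<open>
  Points that are apart at time \<open>k\<close> were apart at time \<open>m\<close>, so the probabilities of staying apart on
  consecutive blocks multiply.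
\<close>

lemma prob_two_point_law_compose_le:
  fixes M :: "int \<Rightarrow> 'e::finite \<Rightarrow> 'e pmf"
  assumes "n \<le> m" "m \<le> k"
    and "\<And>ab. measure_pmf.prob (two_point_law M m k ab) off_diag \<le> d"
  shows "measure_pmf.prob (two_point_law M n k xy) off_diag
       \<le> measure_pmf.prob (two_point_law M n m xy) off_diag * d"
proof -
  \<comment> \<open>A pair that has merged stays merged.\<close>
  have zero: "measure_pmf.prob (two_point_law M m k ab) off_diag = 0" if "ab \<notin> off_diag" for ab
    using that by (cases ab) (simp add: two_point_law_def vimage_def)
  have "measure_pmf.prob (two_point_law M n k xy) off_diag
      = (\<Sum>ab\<in>UNIV. pmf (two_point_law M n m xy) ab * measure_pmf.prob (two_point_law M m k ab) off_diag)"
    by (simp add: two_point_law_compose[OF assms(1,2)] prob_bind_finite)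
  also have "\<dots> = (\<Sum>ab\<in>off_diag. pmf (two_point_law M n m xy) ab * measure_pmf.prob (two_point_law M m k ab) off_diag)"
    by (rule sum.mono_neutral_right) (auto simp: zero)
  also have "\<dots> \<le> (\<Sum>ab\<in>off_diag. pmf (two_point_law M n m xy) ab * d)"
    by (intro sum_mono mult_left_mono assms) auto
  also have "\<dots> = measure_pmf.prob (two_point_law M n m xy) off_diag * d"
    by (simp add: measure_measure_pmf_finite sum_distrib_right)
  finally show ?thesis .
qed

lemma prob_two_point_law_block_le:
  fixes M :: "int \<Rightarrow> 'e::finite \<Rightarrow> 'e pmf"
  assumes "n \<le> k" "dobrushin (back_prod M n k) \<le> 1/2"
  shows "measure_pmf.prob (two_point_law M n k xy) off_diag \<le> 1 - 1 / (4 * real CARD('e))"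
proof -
  obtain x y where xy: "xy = (x, y)"
    by (cases xy)
  have half: "1/2 \<le> 1 - tv_dist (back_prod M n k x) (back_prod M n k y)"
    using tv_dist_le_dobrushin[of "back_prod M n k" x y] assms(2) by linarith
  have "measure_pmf.prob (two_point_law M n k xy) off_diag
      \<le> 1 - (1 - tv_dist (back_prod M n k x) (back_prod M n k y))\<^sup>2 / real CARD('e)"
    unfolding xy
    by (rule order_trans[OF prob_two_point_law_le_independent[OF assms(1)] prob_pair_off_diag_le])
  also have "\<dots> \<le> 1 - (1/2)\<^sup>2 / real CARD('e)"
    using power_mono[OF half, of 2] by (intro diff_left_mono divide_right_mono) auto
  finally show ?thesis
    by (simp add: power2_eq_square)
qed

text \<open>
  \<open>N\<close> consecutive blocks, each with Dobrushin coefficient below 1/2, end at time \<open>k\<close>.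
\<close>

lemma two_point_law_geometric:
  fixes M :: "int \<Rightarrow> 'e::finite \<Rightarrow> 'e pmf"
  assumes lim: "\<forall>k\<le>0. ((\<lambda>n. dobrushin (back_prod M n k)) \<longlongrightarrow> 0) at_bot" and "k \<le> 0"
  shows "\<exists>n\<le>k. \<forall>xy. measure_pmf.prob (two_point_law M n k xy) off_diag \<le> (1 - 1 / (4 * real CARD('e))) ^ N"
proof (induction N)
  case 0
  show ?case
    by (intro exI[of _ k]) simp
next
  case (Suc N)
  let ?c = "1 - 1 / (4 * real CARD('e))"
  have "1 \<le> real CARD('e)"
    by (simp add: Suc_leI)
  then have "1 / (4 * real CARD('e)) \<le> 1"
    by (intro divide_le_eq_1_pos[THEN iffD2]) linarith+
  then have c: "0 \<le> ?c"
    by linarith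
  obtain m where m: "m \<le> k" "\<And>xy. measure_pmf.prob (two_point_law M m k xy) off_diag \<le> ?c ^ N"
    using Suc by blast
  obtain n where n: "n < m" "dobrushin (back_prod M n m) < 1/2"
    using ex_small_dobrushin_block[OF lim[rule_format, OF order_trans[OF m(1) assms(2)]]] by blast
  have "measure_pmf.prob (two_point_law M n k xy) off_diag \<le> ?c ^ Suc N" for xy
  proof -
    have "measure_pmf.prob (two_point_law M n k xy) off_diag
        \<le> measure_pmf.prob (two_point_law M n m xy) off_diag * ?c ^ N"
      using n m by (intro prob_two_point_law_compose_le) auto
    also have "\<dots> \<le> ?c * ?c ^ N"
      using n c by (intro mult_right_mono prob_two_point_law_block_le) auto
    finally show ?thesis
      by simp
  qed
  then show ?case
    using n m by (intro exI[of _ n]) auto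
qed

lemma two_point_law_tendsto_0:
  fixes M :: "int \<Rightarrow> 'e::finite \<Rightarrow> 'e pmf"
  assumes "\<forall>k\<le>0. ((\<lambda>n. dobrushin (back_prod M n k)) \<longlongrightarrow> 0) at_bot" and "k \<le> 0"
  shows "((\<lambda>n. measure_pmf.prob (two_point_law M n k xy) off_diag) \<longlongrightarrow> 0) at_bot"
proof (rule order_tendstoI)
  fix a :: real
  assume "a < 0"
  then show "eventually (\<lambda>n. a < measure_pmf.prob (two_point_law M n k xy) off_diag) at_bot"
    by (intro always_eventually allI less_le_trans[OF _ measure_nonneg])
next
  fix a :: real
  assume "0 < a"
  moreover have "1 - 1 / (4 * real CARD('e)) < 1"
    by simp
  ultimately obtain N where N: "(1 - 1 / (4 * real CARD('e))) ^ N < a"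
    using real_arch_pow_inv by blast
  obtain m where m: "m \<le> k"
    "\<And>xy. measure_pmf.prob (two_point_law M m k xy) off_diag \<le> (1 - 1 / (4 * real CARD('e))) ^ N"
    using two_point_law_geometric[OF assms] by blast
  have "measure_pmf.prob (two_point_law M n k xy) off_diag < a" if "n \<le> m" for n
  proof -
    have "0 \<le> (1 - 1 / (4 * real CARD('e))) ^ N"
      by (rule order_trans[OF measure_nonneg m(2)])
    then have "measure_pmf.prob (two_point_law M n m xy) off_diag * (1 - 1 / (4 * real CARD('e))) ^ N
        \<le> 1 * (1 - 1 / (4 * real CARD('e))) ^ N"
      by (intro mult_right_mono) auto
    moreover have "measure_pmf.prob (two_point_law M n k xy) off_diag
        \<le> measure_pmf.prob (two_point_law M n m xy) off_diag * (1 - 1 / (4 * real CARD('e))) ^ N"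
      by (rule prob_two_point_law_compose_le[OF that m])
    ultimately show ?thesis
      using N by linarith
  qed
  then show "eventually (\<lambda>n. measure_pmf.prob (two_point_law M n k xy) off_diag < a) at_bot"
    by (auto simp: eventually_at_bot_linorder)
qed

section \<open>Pathwise coalescence\<close>

lemma is_singleton_range_iff: "is_singleton (range f) \<longleftrightarrow> (\<forall>x y. f x = f y)"
proof
  assume "\<forall>x y. f x = f y"
  then have "range f = {f undefined}"
    by auto
  then show "is_singleton (range f)"
    by (simp add: is_singleton_def)
next
  assume "is_singleton (range f)"
  then obtain c where "range f = {c}"
    by (auto simp: is_singleton_def)
  then show "\<forall>x y. f x = f y"
    by (metis rangeI singletonD)
qed

lemma comp_maps_compose:
  assumes "m \<le> n" "n \<le> k"
  shows "comp_maps \<omega> m k = comp_maps \<omega> n k \<circ> comp_maps \<omega> m n"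
  using assms(2)
proof (induction k rule: int_ge_induct)
  case base
  show ?case
    by (simp add: comp_maps.simps[of _ n n])
next
  case (step i)
  then show ?case
    using assms(1) by (simp add: comp_maps.simps[of _ _ "i + 1"] o_assoc)
qed

text \<open>
  Composing a constant map with anything applied before it changes nothing. This makes the
  coalescence events monotone in the starting time.
\<close>

lemma comp_maps_constant_earlier:
  assumes "is_singleton (range (comp_maps \<omega> n k))" "m \<le> n" "n \<le> k"
  shows "comp_maps \<omega> m k = comp_maps \<omega> n k"
  using assms by (auto simp: comp_maps_compose[OF assms(2,3)] is_singleton_range_iff fun_eq_iff)

lemma coal_time_finite_iff:
  "coal_time \<omega> k > -\<infinity> \<longleftrightarrow> (\<exists>n<k. is_singleton (range (comp_maps \<omega> n k)))"
  by (auto simp: coal_time_def less_SUP_iff)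

text \<open>
  The coalescence time is the largest time \<open>m\<close> from which the flow is constant, and \<open>m \<ge> n\<close>; so the
  flow from \<open>m\<close> is constant and agrees with the flow from \<open>n\<close>.
\<close>

lemma coal_map_eq:
  assumes "n < k" "is_singleton (range (comp_maps \<omega> n k))"
  shows "coal_map \<omega> k = comp_maps \<omega> n k"
proof -
  define S where "S = {n. n < k \<and> is_singleton (range (comp_maps \<omega> n k))}"
  define m where "m = Max (S \<inter> {n..k})"
  have fin: "finite (S \<inter> {n..k})" and n: "n \<in> S \<inter> {n..k}"
    using assms by (auto simp: S_def)
  have "m \<in> S \<inter> {n..k}"
    unfolding m_def using fin n by (intro Max_in) auto
  then have m: "m \<in> S" "n \<le> m"
    by auto
  have max: "j \<le> m" if "j \<in> S" for j
  proof (cases "n \<le> j")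
    case True
    then show ?thesis
      unfolding m_def using that fin by (intro Max_ge) (auto simp: S_def)
  qed (use m in auto)
  have "coal_time \<omega> k = ereal (of_int m)"
    unfolding coal_time_def S_def[symmetric]
    by (rule antisym) (auto intro!: SUP_least SUP_upper2[OF m(1)] max)
  then have "coal_map \<omega> k = comp_maps \<omega> m k"
    by (simp add: coal_map_def)
  also have "\<dots> = comp_maps \<omega> n k"
    using m by (intro comp_maps_constant_earlier[symmetric]) (auto simp: S_def)
  finally show ?thesis .
qed

text \<open>
  On this event the coalescence time is \<open>-\<infinity>\<close>, whose real part is 0 by convention, so the composition
  is over an empty set of times.
\<close>

lemma coal_map_not_coalesced:
  assumes "\<not> (\<exists>n<k. is_singleton (range (comp_maps \<omega> n k)))" "k \<le> 0"
  shows "coal_map \<omega> k = id"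
proof -
  have "coal_time \<omega> k = -\<infinity>"
    using assms(1) unfolding coal_time_finite_iff[symmetric] by simp
  then show ?thesis
    using assms(2) by (simp add: coal_map_def comp_maps.simps)
qed


section \<open>The coupling measure\<close>

lemma (in finite_measure) abs_measure_diff_le:
  assumes "A \<in> sets M" "B \<in> sets M" "C \<in> sets M" "A \<subseteq> B \<union> C" "B \<subseteq> A \<union> C"
  shows "\<bar>measure M A - measure M B\<bar> \<le> measure M C"
proof -
  have "measure M A \<le> measure M B + measure M C" "measure M B \<le> measure M A + measure M C"
    using assms by (auto intro!: order_trans[OF finite_measure_mono measure_Un_le])
  then show ?thesis
    by linarith
qed

text \<open>
  The product \<open>\<sigma>\<close>-algebra on the finite set of maps is the full power set.
\<close>

lemma coordinate_measurable:
  assumes "k \<le> 0"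
  shows "(\<lambda>\<omega>. \<omega> k) \<in> coupling M \<rightarrow>\<^sub>M count_space UNIV"
proof -
  have "sets (\<Pi>\<^sub>M x\<in>UNIV. measure_pmf (M k x)) = sets (\<Pi>\<^sub>M x\<in>(UNIV :: 'a set). count_space UNIV)"
    by (intro sets_PiM_cong) auto
  also have "\<dots> = sets (count_space UNIV)"
    by (subst count_space_PiM_finite) (auto simp: PiE_UNIV_domain)
  finally have "sets (\<Pi>\<^sub>M x\<in>UNIV. measure_pmf (M k x)) = sets (count_space UNIV)" .
  moreover have "(\<lambda>\<omega>. \<omega> k) \<in> coupling M \<rightarrow>\<^sub>M (\<Pi>\<^sub>M x\<in>UNIV. measure_pmf (M k x))"
    unfolding coupling_def using assms by (intro measurable_component_singleton) auto
  ultimately show ?thesis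
    by (metis measurable_cong_sets)
qed

lemma comp_maps_measurable:
  assumes "k \<le> 0"
  shows "(\<lambda>\<omega>. comp_maps \<omega> n k) \<in> coupling M \<rightarrow>\<^sub>M count_space UNIV"
proof (cases "n \<le> k")
  case True
  then show ?thesis
    using assms
  proof (induction k rule: int_ge_induct)
    case base
    show ?case
      by (simp add: comp_maps.simps)
  next
    case (step i)
    have "(\<lambda>\<omega>. \<omega> (i + 1) \<circ> \<phi>) \<in> coupling M \<rightarrow>\<^sub>M count_space UNIV" for \<phi>
      using step.prems by (intro measurable_compose[OF coordinate_measurable]) auto
    from measurable_compose_countable[OF this step.IH]
    have "(\<lambda>\<omega>. \<omega> (i + 1) \<circ> comp_maps \<omega> n i) \<in> coupling M \<rightarrow>\<^sub>M count_space UNIV"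
      using step.prems by simp
    then show ?case
      using step.hyps by (simp add: comp_maps.simps[of _ n "i + 1"] o_def)
  qed
next
  case False
  then show ?thesis
    by (simp add: comp_maps.simps)
qed

lemma comp_maps_event:
  assumes "k \<le> 0"
  shows "{\<omega> \<in> space (coupling M). P (comp_maps \<omega> n k)} \<in> sets (coupling M)"
  using measurable_sets[OF comp_maps_measurable[OF assms, where n = n and M = M], of "Collect P"]
  by (simp add: vimage_def Int_def conj_commute)

text \<open>
  The event depends on finitely many coordinates with finitely many values, so it is a finite
  disjoint union of cylinders whose probabilities are products of transition probabilities.
\<close>

lemma prob_comp_maps:
  fixes M :: "int \<Rightarrow> 'e::finite \<Rightarrow> 'e pmf"
  assumes k: "k \<le> 0"
  shows "measure (coupling M) {\<omega> \<in> space (coupling M). P (comp_maps \<omega> n k)}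
       = measure_pmf.prob (flow_law M n k) {\<phi>. P \<phi>}"
proof -
  interpret prob_space "coupling M"
    by (rule prob_space_coupling)
  let ?J = "{n<..k}" and ?p = "Pi_pmf {n<..k} undefined (map_law M)"
  define F :: "(int \<Rightarrow> 'e \<Rightarrow> 'e) set" where "F = PiE ?J (\<lambda>_. UNIV)"
  define FP where "FP = {f \<in> F. P (comp_maps f n k)}"
  define C where "C f = {\<omega> \<in> space (coupling M). \<forall>j\<in>?J. \<forall>x. \<omega> j x \<in> {f j x}}" for f
  have fin: "finite F" "finite FP"
    unfolding FP_def by (simp_all add: F_def finite_PiE)
  have C_sets: "C f \<in> sets (coupling M)" for f
  proof -
    have "C f = {\<omega> \<in> space (coupling M). \<forall>j\<in>?J. \<omega> j = f j}"
      by (auto simp: C_def fun_eq_iff)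
    moreover have "{\<omega> \<in> space (coupling M). \<omega> j = f j} \<in> sets (coupling M)" if "j \<in> ?J" for j
      using measurable_sets[OF coordinate_measurable[where k = j and M = M], of "{f j}"] that k
      by (simp add: vimage_def Int_def conj_commute)
    ultimately show ?thesis
      by (simp add: sets.sets_Collect_finite_All)
  qed
  have disj: "disjoint_family_on C FP"
  proof (unfold disjoint_family_on_def, intro ballI impI)
    fix f g
    assume fg: "f \<in> FP" "g \<in> FP" "f \<noteq> g"
    then obtain j where j: "j \<in> ?J" "f j \<noteq> g j"
      by (auto simp: FP_def F_def fun_eq_iff[of f g] PiE_def extensional_def) metis
    then show "C f \<inter> C g = {}"
      by (auto simp: C_def fun_eq_iff[of "f j"])
  qed
  have "{\<omega> \<in> space (coupling M). P (comp_maps \<omega> n k)} = (\<Union>f\<in>FP. C f)"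
  proof (intro equalityI subsetI)
    fix \<omega>
    assume \<omega>: "\<omega> \<in> {\<omega> \<in> space (coupling M). P (comp_maps \<omega> n k)}"
    have "comp_maps (restrict \<omega> ?J) n k = comp_maps \<omega> n k"
      by (rule comp_maps_cong) auto
    with \<omega> have "restrict \<omega> ?J \<in> FP" "\<omega> \<in> C (restrict \<omega> ?J)"
      by (auto simp: FP_def F_def C_def)
    then show "\<omega> \<in> (\<Union>f\<in>FP. C f)"
      by blast
  next
    fix \<omega>
    assume "\<omega> \<in> (\<Union>f\<in>FP. C f)"
    then obtain f where f: "f \<in> FP" "\<omega> \<in> C f"
      by blast
    then have "comp_maps \<omega> n k = comp_maps f n k"
      by (intro comp_maps_cong) (auto simp: C_def fun_eq_iff)
    then show "\<omega> \<in> {\<omega> \<in> space (coupling M). P (comp_maps \<omega> n k)}"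
      using f by (simp add: FP_def C_def)
  qed
  then have "prob {\<omega> \<in> space (coupling M). P (comp_maps \<omega> n k)} = (\<Sum>f\<in>FP. prob (C f))"
    using fin C_sets disj by (simp add: finite_measure_finite_Union image_subset_iff)
  also have "\<dots> = (\<Sum>f\<in>FP. pmf ?p f)"
  proof (rule sum.cong)
    fix f
    assume "f \<in> FP"
    then have "pmf ?p f = (\<Prod>j\<in>?J. \<Prod>x\<in>UNIV. pmf (M j x) (f j x))"
      by (simp add: pmf_Pi FP_def F_def PiE_iff extensional_def map_law_def)
    also have "\<dots> = prob (C f)"
      unfolding C_def using k by (subst coupling_cylinder) (auto simp: measure_pmf_single)
    finally show "prob (C f) = pmf ?p f"
      by simp
  qed simp
  also have "\<dots> = measure_pmf.prob ?p FP"
    using fin by (simp add: measure_measure_pmf_finite)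
  also have "\<dots> = measure_pmf.prob ?p {f. P (comp_maps f n k)}"
  proof (rule measure_prob_cong_0)
    show "pmf ?p f = 0" if "f \<in> {f. P (comp_maps f n k)} - FP" for f
      using that by (auto simp: FP_def F_def PiE_iff extensional_def pmf_Pi)
  qed (auto simp: FP_def)
  finally show ?thesis
    by (simp add: flow_law_def vimage_def)
qed

lemma prob_flow_not_constant_le:
  fixes M :: "int \<Rightarrow> 'e::finite \<Rightarrow> 'e pmf"
  shows "measure_pmf.prob (flow_law M n k) {\<phi>. \<not> is_singleton (range \<phi>)}
       \<le> (\<Sum>xy\<in>UNIV. measure_pmf.prob (two_point_law M n k xy) off_diag)"
proof -
  have "measure_pmf.prob (flow_law M n k) {\<phi>. \<not> is_singleton (range \<phi>)}
      \<le> measure_pmf.prob (flow_law M n k) (\<Union>xy\<in>UNIV. {\<phi>. \<phi> (fst xy) \<noteq> \<phi> (snd xy)})"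
    by (rule measure_pmf.finite_measure_mono) (auto simp: is_singleton_range_iff, blast)
  also have "\<dots> \<le> (\<Sum>xy\<in>UNIV. measure_pmf.prob (flow_law M n k) {\<phi>. \<phi> (fst xy) \<noteq> \<phi> (snd xy)})"
    by (rule measure_pmf.finite_measure_subadditive_finite) auto
  also have "\<dots> = (\<Sum>xy\<in>UNIV. measure_pmf.prob (two_point_law M n k xy) off_diag)"
    by (simp add: two_point_law_def case_prod_beta vimage_def)
  finally show ?thesis .
qed

lemma prob_flow_not_constant_mono:
  fixes M :: "int \<Rightarrow> 'e::finite \<Rightarrow> 'e pmf"
  assumes "m \<le> n" "n \<le> k" "k \<le> 0"
  shows "measure_pmf.prob (flow_law M m k) {\<phi>. \<not> is_singleton (range \<phi>)}
       \<le> measure_pmf.prob (flow_law M n k) {\<phi>. \<not> is_singleton (range \<phi>)}"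
proof -
  interpret prob_space "coupling M"
    by (rule prob_space_coupling)
  show ?thesis
    unfolding prob_comp_maps[OF assms(3), symmetric]
    by (intro finite_measure_mono comp_maps_event[OF assms(3), where P = "\<lambda>\<phi>. \<not> is_singleton (range \<phi>)"])
       (use assms comp_maps_constant_earlier[of _ n k m] in force)
qed

text \<open>
  The events that the flow started at time \<open>n\<close> is not constant at time \<open>k\<close> decrease, as \<open>n \<rightarrow> -\<infinity>\<close>, to the event that the
  coalescence time is \<open>-\<infinity>\<close>.
\<close>

lemma as_coalescing_iff:
  fixes M :: "int \<Rightarrow> 'e::finite \<Rightarrow> 'e pmf"
  shows "as_coalescing M \<longleftrightarrow>
    (\<forall>k\<le>0. ((\<lambda>n. measure_pmf.prob (flow_law M n k) {\<phi>. \<not> is_singleton (range \<phi>)}) \<longlongrightarrow> 0) at_bot)"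
  unfolding as_coalescing_def
proof (intro all_cong1 imp_cong[OF refl])
  fix k :: int
  assume k: "k \<le> 0"
  interpret prob_space "coupling M"
    by (rule prob_space_coupling)
  define p where "p n = measure_pmf.prob (flow_law M n k) {\<phi>. \<not> is_singleton (range \<phi>)}" for n
  define N where "N n = {\<omega> \<in> space (coupling M). \<not> is_singleton (range (comp_maps \<omega> n k))}" for n
  have N: "N n \<in> events" "prob (N n) = p n" for n
    unfolding N_def p_def
    by (rule comp_maps_event[OF k, where P = "\<lambda>\<phi>. \<not> is_singleton (range \<phi>)"],
        rule prob_comp_maps[OF k, where P = "\<lambda>\<phi>. \<not> is_singleton (range \<phi>)"])
  define D where "D = (\<Inter>i. N (k - 1 - int i))"
  have D: "D \<in> events"
    unfolding D_def using N(1) by (intro sets.countable_INT) auto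
  have p_mono: "p m \<le> p n" if "m \<le> n" "n \<le> k" for m n
    unfolding p_def by (rule prob_flow_not_constant_mono[OF that k])
  have dec: "decseq (\<lambda>i. N (k - 1 - int i))"
    unfolding decseq_def
  proof (intro allI impI)
    fix i j :: nat
    assume "i \<le> j"
    then show "N (k - 1 - int j) \<subseteq> N (k - 1 - int i)"
      using comp_maps_constant_earlier[of _ "k - 1 - int i" k "k - 1 - int j"] by (force simp: N_def)
  qed
  have "{\<omega> \<in> space (coupling M). coal_time \<omega> k > -\<infinity>} = space (coupling M) - D"
  proof -
    have "(\<exists>n<k. is_singleton (range (comp_maps \<omega> n k))) \<longleftrightarrow>
        (\<exists>i. is_singleton (range (comp_maps \<omega> (k - 1 - int i) k)))" for \<omega>
    proof
      assume "\<exists>n<k. is_singleton (range (comp_maps \<omega> n k))"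
      then obtain n where "n < k" "is_singleton (range (comp_maps \<omega> n k))"
        by blast
      then show "\<exists>i. is_singleton (range (comp_maps \<omega> (k - 1 - int i) k))"
        by (intro exI[of _ "nat (k - 1 - n)"]) auto
    next
      assume "\<exists>i. is_singleton (range (comp_maps \<omega> (k - 1 - int i) k))"
      then obtain i where "is_singleton (range (comp_maps \<omega> (k - 1 - int i) k))"
        by blast
      then show "\<exists>n<k. is_singleton (range (comp_maps \<omega> n k))"
        by (intro exI[of _ "k - 1 - int i"]) auto
    qed
    then show ?thesis
      unfolding coal_time_finite_iff by (auto simp: D_def N_def)
  qed
  then have "prob {\<omega> \<in> space (coupling M). coal_time \<omega> k > -\<infinity>} = 1 - prob D"
    using prob_compl[OF D] by simp
  moreover have "prob D = 0 \<longleftrightarrow> (p \<longlongrightarrow> 0) at_bot"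
  proof
    assume "prob D = 0"
    moreover have "(\<lambda>i. prob (N (k - 1 - int i))) \<longlonglongrightarrow> prob D"
      unfolding D_def using N(1) dec by (intro finite_Lim_measure_decseq) auto
    ultimately have lim: "(\<lambda>i. p (k - 1 - int i)) \<longlonglongrightarrow> 0"
      by (simp add: N)
    show "(p \<longlongrightarrow> 0) at_bot"
    proof (rule order_tendstoI)
      fix a :: real
      assume "a < 0"
      then show "eventually (\<lambda>n. a < p n) at_bot"
        unfolding p_def by (intro always_eventually allI less_le_trans[OF _ measure_nonneg])
    next
      fix a :: real
      assume "0 < a"
      then obtain i where i: "p (k - 1 - int i) < a"
        using order_tendstoD(2)[OF lim] eventually_happens'[OF sequentially_bot] by blast
      have "p n < a" if "n \<le> k - 1 - int i" for n
        using p_mono[OF that] i by simp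
      then show "eventually (\<lambda>n. p n < a) at_bot"
        by (auto simp: eventually_at_bot_linorder)
    qed
  next
    assume lim: "(p \<longlongrightarrow> 0) at_bot"
    have "prob D \<le> p n" if "n < k" for n
    proof -
      have "D \<subseteq> N (k - 1 - int (nat (k - 1 - n)))"
        unfolding D_def by (rule INT_lower) simp
      then have "D \<subseteq> N n"
        using that by simp
      then show ?thesis
        using N finite_measure_mono by metis
    qed
    then have "eventually (\<lambda>n. prob D \<le> p n) at_bot"
      by (auto simp: eventually_at_bot_dense)
    then have "prob D \<le> 0"
      by (rule tendsto_lowerbound[OF lim]) simp
    then show "prob D = 0"
      by (simp add: measure_le_0_iff)
  qed
  ultimately show "(prob {\<omega> \<in> space (coupling M). coal_time \<omega> k > -\<infinity>} = 1) \<longleftrightarrow>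
      ((\<lambda>n. measure_pmf.prob (flow_law M n k) {\<phi>. \<not> is_singleton (range \<phi>)}) \<longlongrightarrow> 0) at_bot"
    by (simp add: p_def[abs_def])
qed

section \<open>Weak ergodicity and almost sure coalescence\<close>

lemma weak_ergodicity_imp_as_coalescing:
  fixes M :: "int \<Rightarrow> 'e::finite \<Rightarrow> 'e pmf"
  assumes "\<forall>k\<le>0. ((\<lambda>n. dobrushin (back_prod M n k)) \<longlongrightarrow> 0) at_bot"
  shows "as_coalescing M"
  unfolding as_coalescing_iff
proof (intro allI impI)
  fix k :: int
  assume k: "k \<le> 0"
  have lim: "((\<lambda>n. \<Sum>xy\<in>UNIV. measure_pmf.prob (two_point_law M n k xy) off_diag) \<longlongrightarrow> 0) at_bot"
    by (intro tendsto_null_sum two_point_law_tendsto_0 assms k)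
  show "((\<lambda>n. measure_pmf.prob (flow_law M n k) {\<phi>. \<not> is_singleton (range \<phi>)}) \<longlongrightarrow> 0) at_bot"
    by (rule Lim_null_comparison[OF _ lim]) (simp add: prob_flow_not_constant_le)
qed

text \<open>
  The coupling inequality: the two rows are the laws of the images of \<open>x\<close> and \<open>x'\<close>, which agree when the
  flow is constant.
\<close>

lemma one_point_coalescence_bound:
  fixes M :: "int \<Rightarrow> 'e::finite \<Rightarrow> 'e pmf"
  assumes "n \<le> k"
  shows "\<bar>pmf (back_prod M n k x) z - pmf (back_prod M n k x') z\<bar>
       \<le> measure_pmf.prob (flow_law M n k) {\<phi>. \<not> is_singleton (range \<phi>)}"
proof -
  have pmf_eq: "pmf (back_prod M n k w) z = measure_pmf.prob (flow_law M n k) {\<phi>. \<phi> w = z}" for w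
    unfolding one_point_flow_law[OF assms, symmetric] pmf_map by (simp add: vimage_def)
  have same_value: "\<phi> x = \<phi> x'" if "is_singleton (range \<phi>)" for \<phi> :: "'e \<Rightarrow> 'e"
    using that by (metis is_singleton_range_iff)
  have "\<bar>measure_pmf.prob (flow_law M n k) {\<phi>. \<phi> x = z} - measure_pmf.prob (flow_law M n k) {\<phi>. \<phi> x' = z}\<bar>
      \<le> measure_pmf.prob (flow_law M n k) {\<phi>. \<not> is_singleton (range \<phi>)}"
  proof (rule measure_pmf.abs_measure_diff_le)
    show "{\<phi>. \<phi> x = z} \<subseteq> {\<phi>. \<phi> x' = z} \<union> {\<phi>. \<not> is_singleton (range \<phi>)}"
      by (auto dest: same_value)
    show "{\<phi>. \<phi> x' = z} \<subseteq> {\<phi>. \<phi> x = z} \<union> {\<phi>. \<not> is_singleton (range \<phi>)}"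
      by (auto dest: same_value)
  qed simp_all
  then show ?thesis
    unfolding pmf_eq .
qed

lemma as_coalescing_imp_weak_ergodicity:
  fixes M :: "int \<Rightarrow> 'e::finite \<Rightarrow> 'e pmf"
  assumes "as_coalescing M" "k \<le> 0"
  shows "((\<lambda>n. pmf (back_prod M n k x) z - pmf (back_prod M n k x') z) \<longlongrightarrow> 0) at_bot"
proof (rule Lim_null_comparison)
  show "((\<lambda>n. measure_pmf.prob (flow_law M n k) {\<phi>. \<not> is_singleton (range \<phi>)}) \<longlongrightarrow> 0) at_bot"
    using assms by (simp add: as_coalescing_iff)
  show "eventually (\<lambda>n. norm (pmf (back_prod M n k x) z - pmf (back_prod M n k x') z)
      \<le> measure_pmf.prob (flow_law M n k) {\<phi>. \<not> is_singleton (range \<phi>)}) at_bot"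
    unfolding real_norm_def
    by (rule eventually_mono[OF eventually_le_at_bot[of k]]) (rule one_point_coalescence_bound)
qed

section \<open>The law of the coalesced map\<close>

lemma coal_map_event:
  fixes M :: "int \<Rightarrow> 'e::finite \<Rightarrow> 'e pmf"
  assumes k: "k \<le> 0"
  shows "{\<omega> \<in> space (coupling M). coal_map \<omega> k x \<in> A} \<in> sets (coupling M)"
proof -
  let ?Q = "coupling M" and ?c = "\<lambda>\<omega> n. is_singleton (range (comp_maps \<omega> n k))"
  let ?S = "\<Union>n\<in>{..<k}. {\<omega> \<in> space ?Q. ?c \<omega> n \<and> comp_maps \<omega> n k x \<in> A}"
  let ?R = "\<Union>n\<in>{..<k}. {\<omega> \<in> space ?Q. ?c \<omega> n}"
  have S: "?S \<in> sets ?Q"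
    by (intro sets.countable_UN' countableI_type image_subsetI
        comp_maps_event[OF k, where P = "\<lambda>\<phi>. is_singleton (range \<phi>) \<and> \<phi> x \<in> A"])
  have R: "?R \<in> sets ?Q"
    by (intro sets.countable_UN' countableI_type image_subsetI
        comp_maps_event[OF k, where P = "\<lambda>\<phi>. is_singleton (range \<phi>)"])
  have coal_iff: "coal_map \<omega> k x \<in> A \<longleftrightarrow>
      (\<exists>n<k. ?c \<omega> n \<and> comp_maps \<omega> n k x \<in> A) \<or> (x \<in> A \<and> \<not> (\<exists>n<k. ?c \<omega> n))" for \<omega>
  proof (cases "\<exists>n<k. ?c \<omega> n")
    case True
    then show ?thesis
      by (metis coal_map_eq)
  next
    case False
    then show ?thesis
      using coal_map_not_coalesced[OF False k] by (metis id_apply)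
  qed
  have "{\<omega> \<in> space ?Q. coal_map \<omega> k x \<in> A} = ?S \<union> (if x \<in> A then space ?Q - ?R else {})"
    unfolding coal_iff by (cases "x \<in> A") (simp_all, blast+)
  then show ?thesis
    using S R by simp
qed

text \<open>
  The coalesced map agrees with the flow started at time \<open>n\<close> whenever the latter is constant, an event whose
  probability tends to 1.
\<close>

lemma tendsto_prob_coal_map:
  fixes M :: "int \<Rightarrow> 'e::finite \<Rightarrow> 'e pmf"
  assumes "as_coalescing M" and k: "k \<le> 0"
  shows "((\<lambda>n. measure_pmf.prob (back_prod M n k x) A) \<longlongrightarrow>
           measure (coupling M) {\<omega> \<in> space (coupling M). coal_map \<omega> k x \<in> A}) at_bot"
proof -
  interpret prob_space "coupling M"
    by (rule prob_space_coupling)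
  let ?q = "prob {\<omega> \<in> space (coupling M). coal_map \<omega> k x \<in> A}"
  have bound: "norm (measure_pmf.prob (back_prod M n k x) A - ?q)
      \<le> measure_pmf.prob (flow_law M n k) {\<phi>. \<not> is_singleton (range \<phi>)}" if "n < k" for n
  proof -
    have "measure_pmf.prob (back_prod M n k x) A = prob {\<omega> \<in> space (coupling M). comp_maps \<omega> n k x \<in> A}"
      unfolding one_point_flow_law[OF less_imp_le[OF that], symmetric]
        prob_comp_maps[OF k, where P = "\<lambda>\<phi>. \<phi> x \<in> A"]
      by (simp add: vimage_def)
    moreover have "\<bar>prob {\<omega> \<in> space (coupling M). comp_maps \<omega> n k x \<in> A} - ?q\<bar>
        \<le> prob {\<omega> \<in> space (coupling M). \<not> is_singleton (range (comp_maps \<omega> n k))}"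
      using coal_map_eq[OF that, where 'a = 'e]
      by (intro abs_measure_diff_le coal_map_event k comp_maps_event[where P = "\<lambda>\<phi>. \<phi> x \<in> A"]
          comp_maps_event[where P = "\<lambda>\<phi>. \<not> is_singleton (range \<phi>)"] subsetI) force+
    ultimately show ?thesis
      by (simp add: prob_comp_maps[OF k, where P = "\<lambda>\<phi>. \<not> is_singleton (range \<phi>)"])
  qed
  have "((\<lambda>n. measure_pmf.prob (back_prod M n k x) A - ?q) \<longlongrightarrow> 0) at_bot"
  proof (rule Lim_null_comparison)
    show "((\<lambda>n. measure_pmf.prob (flow_law M n k) {\<phi>. \<not> is_singleton (range \<phi>)}) \<longlongrightarrow> 0) at_bot"
      using assms by (simp add: as_coalescing_iff)
    show "eventually (\<lambda>n. norm (measure_pmf.prob (back_prod M n k x) A - ?q)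
        \<le> measure_pmf.prob (flow_law M n k) {\<phi>. \<not> is_singleton (range \<phi>)}) at_bot"
      using bound by (auto simp: eventually_at_bot_dense)
  qed
  then show ?thesis
    by (rule LIM_zero_cancel)
qed

section \<open>Equivalence of weak ergodicity and coalescence\<close>

theorem theorem1:
  fixes M :: "int \<Rightarrow> 'e::finite \<Rightarrow> 'e pmf"
  shows
    "((\<forall>k\<le>0. \<forall>x x' z.
          ((\<lambda>n. pmf (back_prod M n k x) z - pmf (back_prod M n k x') z) \<longlongrightarrow> 0) at_bot)
        \<longleftrightarrow> as_coalescing M) \<and>
     (card (absolute_probs M) = 1 \<longleftrightarrow> as_coalescing M) \<and>
     ((\<forall>k\<le>0. ((\<lambda>n. dobrushin (back_prod M n k)) \<longlongrightarrow> 0) at_bot) \<longleftrightarrow> as_coalescing M) \<and>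
     ((\<exists>t :: nat \<Rightarrow> int. (\<forall>i. t i \<le> 0) \<and> (\<forall>i j. i < j \<longrightarrow> t j < t i) \<and>
          (\<Sum>i. ennreal (1 - dobrushin (back_prod M (t (Suc i)) (t i)))) = \<infinity>)
        \<longleftrightarrow> as_coalescing M) \<and>
     (as_coalescing M \<longrightarrow>
       (\<exists>\<pi>. absolute_probs M = {\<pi>} \<and>
          (\<forall>n\<le>0. \<forall>x A. measure (coupling M) {\<omega> \<in> space (coupling M). coal_map \<omega> n x \<in> A}
                        = measure_pmf.prob (\<pi> n) A)))"
proof -
  let ?rows = "\<forall>k\<le>0. \<forall>x x' z.
    ((\<lambda>n. pmf (back_prod M n k x) z - pmf (back_prod M n k x') z) \<longlongrightarrow> 0) at_bot"
  let ?dob = "\<forall>k\<le>0. ((\<lambda>n. dobrushin (back_prod M n k)) \<longlongrightarrow> 0) at_bot"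
  let ?blocks = "\<exists>t :: nat \<Rightarrow> int. (\<forall>i. t i \<le> 0) \<and> (\<forall>i j. i < j \<longrightarrow> t j < t i) \<and>
    (\<Sum>i. ennreal (1 - dobrushin (back_prod M (t (Suc i)) (t i)))) = \<infinity>"
  let ?law = "\<exists>\<pi>. absolute_probs M = {\<pi>} \<and>
    (\<forall>n\<le>0. \<forall>x A. measure (coupling M) {\<omega> \<in> space (coupling M). coal_map \<omega> n x \<in> A}
                  = measure_pmf.prob (\<pi> n) A)"
  have rows_dob: "?rows \<longleftrightarrow> ?dob"
    unfolding tendsto_dobrushin_iff ..
  have dob: "?dob \<longleftrightarrow> as_coalescing M"
  proof
    assume ?dob
    then show "as_coalescing M"
      by (rule weak_ergodicity_imp_as_coalescing)
  next
    assume "as_coalescing M"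
    then have ?rows
      by (intro allI impI as_coalescing_imp_weak_ergodicity)
    then show ?dob
      unfolding rows_dob .
  qed
  have rows: "?rows \<longleftrightarrow> as_coalescing M"
    unfolding rows_dob by (rule dob)
  have card: "card (absolute_probs M) = 1 \<longleftrightarrow> as_coalescing M"
    unfolding card_absolute_probs_iff by (rule rows)
  have "?blocks \<longleftrightarrow> ?dob"
  proof
    assume ?blocks
    then obtain t :: "nat \<Rightarrow> int" where dec: "\<forall>i j. i < j \<longrightarrow> t j < t i"
      and inf: "(\<Sum>i. ennreal (1 - dobrushin (back_prod M (t (Suc i)) (t i)))) = \<infinity>"
      by (elim exE conjE)
    show ?dob
      by (intro allI impI block_divergence_imp_dobrushin_tendsto[OF dec inf])
  next
    assume ?dob
    then show ?blocks
      by (rule dobrushin_tendsto_imp_block_divergence)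
  qed
  then have blocks: "?blocks \<longleftrightarrow> as_coalescing M"
    using dob by (rule trans)
  have law: "as_coalescing M \<longrightarrow> ?law"
  proof
    assume coal: "as_coalescing M"
    then have "card (absolute_probs M) = 1"
      unfolding card .
    then obtain \<pi> where \<pi>: "absolute_probs M = {\<pi>}"
      by (auto simp: card_1_singleton_iff)
    have "measure (coupling M) {\<omega> \<in> space (coupling M). coal_map \<omega> n x \<in> A} = measure_pmf.prob (\<pi> n) A"
      if n: "n \<le> 0" for n x and A :: "'e set"
    proof -
      have "((\<lambda>m. pmf (back_prod M m n x) z) \<longlongrightarrow> pmf (\<pi> n) z) at_bot" for z
        by (rule back_prod_tendsto_absolute_probs[OF _ n as_coalescing_imp_weak_ergodicity[OF coal n]])
           (simp add: \<pi>)
      then have "((\<lambda>m. measure_pmf.prob (back_prod M m n x) A) \<longlongrightarrow> measure_pmf.prob (\<pi> n) A) at_bot"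
        unfolding measure_measure_pmf_finite[OF finite] by (intro tendsto_sum)
      with tendsto_prob_coal_map[OF coal n] show ?thesis
        by (rule tendsto_unique[OF trivial_limit_at_bot_linorder])
    qed
    with \<pi> show ?law
      by blast
  qed
  show ?thesis
    using rows card dob blocks law by (intro conjI)
qed

end
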